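(* Let $m\in\mathbb{N}_{>0}$, $n_1,\dots,n_m\in\mathbb{N}_{>0}$, and let $X_{ij}$ ($1\le i\le m$, $1\le j\le n_i$) be i.i.d. real random variables with cumulative distribution function $F_X$, where $F_X$ is at least twice continuously differentiable. Let $K$ be a CDF kernel such that the distributions described by $K$ and by $K^2$ have at least first and second moments. For a bandwidth matrix $h=(h_{ij})$ with $h_{ij}>0$ let $\hat F_h$ be the DDEVD estimator, $F_{i,h}$ its $i$-th inner approximation, $F$ the target CDF and $\mathrm{MSE}(y)=\mathbb{E}[(\hat F_h(y)-F(y))^2]$. Let $b_{0,i},b_{1,i},b_{2a,i},b_{2b,i},V_{0,i},V_{1,i},V_{2a,i},V_{2b,i}$ be the specific coefficient functions of $y$ given in the context. Then $\mathrm{MSE}(y)$ has the following asymptotic expansion up to order $\mathcal{O}(h^3)$ (coefficient functions evaluated at $y$, sums over $i=1,\dots,m$): $$\begin{aligned}\mathrm{MSE}(y)&=\frac1{m^2}\Big[\Big(\sum_i b_{0,i}\Big)^2+\sum_i V_{0,i}\Big]\\&\quad+\frac1{m^2}\Big[2\Big(\sum_i b_{0,i}\Big)\Big(\sum_i\bar h_i b_{1,i}\Big)+\sum_i\bar h_iV_{1,i}\Big]\\&\quad+\frac1{m^2}\Big[\Big(\sum_i\bar h_ib_{1,i}\Big)^2+2\Big(\sum_ib_{0,i}\Big)\Big(\sum_i\overline{h_i^2}\,b_{2a,i}+\sum_i\bar h_i^{\,2}\,b_{2b,i}\Big)+\sum_i\Big(\overline{h_i^2}\,V_{2a,i}+\bar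 h_i^{\,2}\,V_{2b,i}\Big)\Big]+\mathcal{O}(h^3).\end{aligned}$$ This stems from the individual expansions of bias and variance: for the $i$-th block, with $\mathrm{Bias}_i(y)=\mathbb{E}[F_{i,h}^{n_i}(y)]-F_X^{n_i}(y)$, $$\mathrm{Bias}_i(y)=b_{0,i}(y)+\bar h_i\,b_{1,i}(y)+\overline{h_i^2}\,b_{2a,i}(y)+\bar h_i^{\,2}\,b_{2b,i}(y)+\mathcal{O}(h^3),$$ $$\mathrm{Var}(F_{i,h}^{n_i})(y)=V_{0,i}(y)+\bar h_i\,V_{1,i}(y)+\overline{h_i^2}\,V_{2a,i}(y)+\bar h_i^{\,2}\,V_{2b,i}(y)+\mathcal{O}(h^3).$$ The overall bias $\mathbb{E}[\hat F_h(y)]-F(y)$ equals $\frac1m\sum_i\mathrm{Bias}_i(y)$ and the overall variance of $\hat F_h(y)$ equals $\frac1{m^2}\sum_i\mathrm{Var}(F_{i,h}^{n_i})(y)$.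
   Context: A CDF kernel is a non-decreasing function $K$ with $\lim_{y\to-\infty}K(y)=0$ and $\lim_{y\to\infty}K(y)=1$. The $i$-th inner approximation is $F_{i,h}(y)=\frac1{n_i}\sum_{j=1}^{n_i}K\big(\frac{y-X_{ij}}{h_{ij}}\big)$ and the DDEVD (data driven extreme value distribution) estimator is $\hat F_h(y)=\frac1m\sum_{i=1}^mF_{i,h}^{n_i}(y)$, with $F_{i,h}^{n_i}(y)=(F_{i,h}(y))^{n_i}$. The target CDF is $F(y)=\frac1m\sum_{i=1}^mF_X(y)^{n_i}$. Notation: $\bar h_i=\frac1{n_i}\sum_jh_{ij}$, $\overline{h_i^2}=\frac1{n_i}\sum_jh_{ij}^2$, $\bar h_i^{\,2}=(\bar h_i)^2$; $\mathcal{O}(h^3)$ collects terms of third and higher order in the bandwidths. Coefficients. Let $f_X=F_X'$, $\mu_{K,p}=\int u^pK'(u)\,du$, $\mu_{K^2,p}=\int u^p(K^2)'(u)\,du$, and (functions of $y$) $$\alpha=f_X\mu_{K^2,1}-2F_Xf_X\mu_{K,1},\qquad \beta=\tfrac12f_X'\mu_{K^2,2}-f_X'F_X\mu_{K,2}-f_X^2\mu_{K,1}^2.$$ For fixed block $i$ and $N\in\mathbb{N}$, with $(-1)!!=1$, put $$Y_{0,N}=\sum_{k=0}^{\lfloor N/2\rfloor}\binom N{2k}(2k-1)!!\,\frac1{n_i^k}F_X^{N-k}(1-F_X)^k,$$ $$Y_{1,N}=-\sum_{k=1}^{\lfloor N/2\rfloor}k\binom N{2k}(2k-1)!!\,\frac1{n_i^k}F_X^{N-k-1}(1-F_X)^{k-1}\alpha,$$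 $$Y_{2\alpha,N}=\sum_{k=2}^{\lfloor N/2\rfloor}\binom N{2k}(2k-1)!!\,\frac{k(k-1)}{2n_i^k}F_X^{N-k-2}(1-F_X)^{k-2}\alpha^2,$$ $$Y_{2\beta,N}=\sum_{k=1}^{\lfloor N/2\rfloor}\binom N{2k}(2k-1)!!\,\frac k{n_i^k}F_X^{N-k-1}(1-F_X)^{k-1}\beta,$$ and $E_{0,N}=Y_{0,N}$, $E_{1,N}=Y_{1,N}-Nf_X\mu_{K,1}Y_{0,N-1}$, $E_{2a,N}=Y_{2\beta,N}+\frac N2f_X'\mu_{K,2}Y_{0,N-1}$, $E_{2b,N}=Y_{2\alpha,N}-Nf_X\mu_{K,1}Y_{1,N-1}+\binom N2f_X^2\mu_{K,1}^2Y_{0,N-2}$. The coefficients are $b_{0,i}=E_{0,n_i}-F_X^{n_i}$, $b_{1,i}=E_{1,n_i}$, $b_{2a,i}=E_{2a,n_i}$, $b_{2b,i}=E_{2b,n_i}$, $V_{0,i}=E_{0,2n_i}-E_{0,n_i}^2$, $V_{1,i}=E_{1,2n_i}-2E_{0,n_i}E_{1,n_i}$, $V_{2a,i}=E_{2a,2n_i}-2E_{0,n_i}E_{2a,n_i}$, $V_{2b,i}=E_{2b,2n_i}-2E_{0,n_i}E_{2b,n_i}-E_{1,n_i}^2$. These formulas are obtained by expanding $\mathbb{E}[F_{i,h}^N]$ binomially around $\mathbb{E}[F_{i,h}]$ and replacing the central moments of $F_{i,h}(y)$ by those of a centred normal variable with the same variance. Large-$n_i$ approximations. With $Z\sim\mathcal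 N(0,1)$ and $c=\frac1{\sqrt{n_i}}\sqrt{\frac{1-F_X}{F_X}}$ one has $Y_{0,N}=F_X^N\,\mathbb{E}[(1+cZ)^N]$, $Y_{1,N}=-\alpha\frac N{2\sqrt{n_i}}\frac{F_X^{N-1}}{\sqrt{F_X(1-F_X)}}\mathbb{E}[Z(1+cZ)^{N-1}]$, $Y_{2\beta,N}=\beta\frac N{2\sqrt{n_i}}\frac{F_X^{N-1}}{\sqrt{F_X(1-F_X)}}\mathbb{E}[Z(1+cZ)^{N-1}]$, $Y_{2\alpha,N}=\alpha^2\frac N{8n_i}\frac{F_X^{N-2}}{F_X(1-F_X)}\mathbb{E}\big[Z\big((N-2)Z-\frac1c\big)(1+cZ)^{N-2}\big]$, and for large $n_i$ one uses $\mathbb{E}[(1+cZ)^N]\approx\rho(c,N):=\frac{e^{N^2c^2/(2(Nc^2+1))}}{\sqrt{Nc^2+1}}$, $\mathbb{E}[Z(1+cZ)^{N-1}]\approx\frac1N\partial_c\rho(c,N)$ and $\mathbb{E}[Z^2(1+cZ)^{N-2}]\approx\frac1{N(N-1)}\partial_c^2\rho(c,N)$.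
   Formalization: Literally false for n_i≥2: proved for bias, variance, MSE with central moments replaced by normal ones; for the true ones only if the replacement errors are of remainder order. O(h^3) means o(|h|^2) unless F_X is C^3 and K, K^2 have third moments. *)

theory Defs
  imports "HOL-Probability.Probability" "HOL-Library.Landau_Symbols"
begin

section \<open>Kernels and their moments\<close>

definition cdf_kernel :: "(real \<Rightarrow> real) \<Rightarrow> bool" where
  "cdf_kernel K \<longleftrightarrow> mono K \<and> (K \<longlongrightarrow> 0) at_bot \<and> (K \<longlongrightarrow> 1) at_top"

text \<open>The distribution described by \<open>K\<close>.  A CDF kernel is only required to be monotone, whereas
  \<^const>\<open>interval_measure\<close> needs a right-continuous argument, hence the right limit.\<close>

definition kernel_dist :: "(real \<Rightarrow> real) \<Rightarrow> real measure" where
  "kernel_dist K = interval_measure (\<lambda>u. Lim (at_right u) K)"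

text \<open>\<open>\<mu>\<^sub>K\<^sub>,\<^sub>p = \<integral> u\<^sup>p K'(u) du\<close>, with \<open>K'(u) du\<close> read as the Lebesgue--Stieltjes measure of \<open>K\<close>, since
  a CDF kernel may have jumps; for differentiable \<open>K\<close> the lemma \<open>kernel_moment_deriv\<close> below gives
  the literal formula.\<close>

definition kernel_moment :: "(real \<Rightarrow> real) \<Rightarrow> nat \<Rightarrow> real" where
  "kernel_moment K p = (\<integral>u. u ^ p \<partial>kernel_dist K)"

definition has_kernel_moment :: "(real \<Rightarrow> real) \<Rightarrow> nat \<Rightarrow> bool" where
  "has_kernel_moment K p \<longleftrightarrow> integrable (kernel_dist K) (\<lambda>u. u ^ p)"

abbreviation (input) ksq :: "(real \<Rightarrow> real) \<Rightarrow> real \<Rightarrow> real" where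
  "ksq K \<equiv> (\<lambda>u. (K u)\<^sup>2)"

lemma cdf_kernel_ksq:
  assumes "cdf_kernel K"
  shows "cdf_kernel (ksq K)"
proof -
  have mono: "mono K" and lim0: "(K \<longlongrightarrow> 0) at_bot" and lim1: "(K \<longlongrightarrow> 1) at_top"
    using assms by (auto simp: cdf_kernel_def)
  have nonneg: "0 \<le> K u" for u
  proof (rule tendsto_upperbound[OF lim0])
    show "\<forall>\<^sub>F x in at_bot. K x \<le> K u"
      using eventually_le_at_bot[of u] by eventually_elim (rule monoD[OF mono])
  qed simp
  have "mono (ksq K)"
    by (intro monoI power_mono monoD[OF mono] nonneg)
  moreover have "(ksq K \<longlongrightarrow> 0) at_bot" "(ksq K \<longlongrightarrow> 1) at_top"
    using tendsto_power[OF lim0, of 2] tendsto_power[OF lim1, of 2] by simp_all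
  ultimately show ?thesis
    by (simp add: cdf_kernel_def)
qed

lemma kernel_dist_density:
  assumes K: "cdf_kernel K" and k: "\<And>u. (K has_real_derivative k u) (at u)"
  shows "k \<in> borel_measurable borel" "\<And>u. 0 \<le> k u"
    and "kernel_dist K = density lborel (\<lambda>u. ennreal (k u))"
proof -
  have mono: "mono K" and lim0: "(K \<longlongrightarrow> 0) at_bot" and lim1: "(K \<longlongrightarrow> 1) at_top"
    using K by (auto simp: cdf_kernel_def)
  have cont: "isCont K u" for u
    using k DERIV_isCont by blast
  have measK: "K \<in> borel_measurable borel"
    using cont by (intro borel_measurable_continuous_onI continuous_at_imp_continuous_on) auto
  have conv: "(\<lambda>i. (K (u + inverse (real (Suc i))) - K u) / inverse (real (Suc i)))
               \<longlonglongrightarrow> k u" for u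
  proof -
    have "((\<lambda>t. (K (u + t) - K u) / t) \<longlongrightarrow> k u) (at 0)"
      using k[of u] by (simp add: DERIV_def)
    moreover have "filterlim (\<lambda>i. inverse (real (Suc i))) (at 0) sequentially"
      by (simp only: filterlim_at LIMSEQ_inverse_real_of_nat) (simp add: eventually_sequentially)
    ultimately show ?thesis
      by (rule filterlim_compose)
  qed
  show kmeas: "k \<in> borel_measurable borel"
    by (rule borel_measurable_LIMSEQ_real[OF conv]) (use measK in measurable)
  show knn: "0 \<le> k u" for u
  proof (rule tendsto_lowerbound[OF conv[of u]])
    show "\<forall>\<^sub>F i in sequentially. 0 \<le> (K (u + inverse (real (Suc i))) - K u) / inverse (real (Suc i))"
      using monoD[OF mono] by (intro always_eventually allI divide_nonneg_nonneg) simp_all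
  qed simp
  have Lim: "Lim (at_right u) K = K u" for u
    using cont[of u] unfolding isCont_def
    by (intro tendsto_Lim) (simp_all add: filterlim_at_split)
  then have dist: "kernel_dist K = interval_measure K"
    by (simp add: kernel_dist_def)
  have rc: "continuous (at_right a) K" for a
    using cont[of a] continuous_at_imp_continuous_at_within by blast
  have Ioc: "emeasure (interval_measure K) {a<..b} = K b - K a" if "a \<le> b" for a b
    using that monoD[OF mono] rc by (rule emeasure_interval_measure_Ioc)
  show "kernel_dist K = density lborel (\<lambda>u. ennreal (k u))"
    unfolding dist
  proof (rule measure_eqI_generator_eq)
    let ?E = "range (\<lambda>(a::real, b::real). {a<..b})"
    show "Int_stable ?E"
      unfolding Int_stable_def image_def
      by clarsimp metis
    show "?E \<subseteq> Pow UNIV" by simp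
    show "sets (interval_measure K) = sigma_sets UNIV ?E"
      by (simp add: borel_sigma_sets_Ioc)
    show "sets (density lborel (\<lambda>u. ennreal (k u))) = sigma_sets UNIV ?E"
      by (simp add: borel_sigma_sets_Ioc)
    show "range (\<lambda>i::nat. {- real i<..real i}) \<subseteq> ?E" by auto
    show "(\<Union>i::nat. {- real i<..real i}) = UNIV"
    proof (rule set_eqI)
      fix x :: real
      obtain i :: nat where "\<bar>x\<bar> < real i" using reals_Archimedean2 by blast
      then show "x \<in> (\<Union>i::nat. {- real i<..real i}) \<longleftrightarrow> x \<in> UNIV"
        by (auto simp: abs_less_iff intro!: exI[of _ i])
    qed
    show "emeasure (interval_measure K) {- real i<..real i} \<noteq> \<infinity>" for i :: nat
      by (simp add: Ioc)
    fix A assume "A \<in> ?E"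
    then obtain a b where A: "A = {a<..b}" by auto
    show "emeasure (interval_measure K) A = emeasure (density lborel (\<lambda>u. ennreal (k u))) A"
    proof (cases "a \<le> b")
      case True
      have "emeasure (density lborel (\<lambda>u. ennreal (k u))) A
          = (\<integral>\<^sup>+u. ennreal (k u) * indicator {a<..b} u \<partial>lborel)"
        using kmeas by (simp add: A emeasure_density)
      also have "\<dots> = (\<integral>\<^sup>+u. ennreal (k u) * indicator {a..b} u \<partial>lborel)"
      proof (rule nn_integral_cong_AE)
        show "AE u in lborel. ennreal (k u) * indicator {a<..b} u = ennreal (k u) * indicator {a..b} u"
          using AE_lborel_singleton[of a] by eventually_elim (auto split: split_indicator)
      qed
      also have "\<dots> = K b - K a"
        using kmeas knn k True
        by (intro nn_integral_FTC_Icc) (auto intro: has_field_derivative_at_within)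
      finally show ?thesis
        using True by (simp add: A Ioc)
    qed (simp add: A)
  qed
qed

lemma kernel_moment_deriv:
  assumes "cdf_kernel K" "\<And>u. (K has_real_derivative k u) (at u)"
  shows "kernel_moment K p = (\<integral>u. u ^ p * k u \<partial>lborel)"
  using kernel_dist_density[OF assms]
  by (simp add: kernel_moment_def integral_density mult.commute)


section \<open>Smoothness\<close>

definition C_diff :: "nat \<Rightarrow> (real \<Rightarrow> real) \<Rightarrow> bool" where
  "C_diff r F \<longleftrightarrow> (\<forall>q<r. \<forall>x. (deriv ^^ q) F differentiable at x) \<and> continuous_on UNIV ((deriv ^^ r) F)"


section \<open>The DDEVD estimator\<close>

text \<open>\<open>X i j\<close> and \<open>h i j\<close> are relevant for \<open>1 \<le> i \<le> m\<close> and \<open>1 \<le> j \<le> n i\<close> only.\<close>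

definition block_indices :: "nat \<Rightarrow> (nat \<Rightarrow> nat) \<Rightarrow> (nat \<times> nat) set" where
  "block_indices m n = (SIGMA i:{1..m}. {1..n i})"

definition inner_approx ::
  "(nat \<Rightarrow> nat \<Rightarrow> 'a \<Rightarrow> real) \<Rightarrow> (real \<Rightarrow> real) \<Rightarrow> (nat \<Rightarrow> nat) \<Rightarrow> (nat \<Rightarrow> nat \<Rightarrow> real) \<Rightarrow> nat \<Rightarrow> real \<Rightarrow> 'a \<Rightarrow> real"
where
  "inner_approx X K n h i y \<omega> = (1 / real (n i)) * (\<Sum>j=1..n i. K ((y - X i j \<omega>) / h i j))"

definition ddevd ::
  "(nat \<Rightarrow> nat \<Rightarrow> 'a \<Rightarrow> real) \<Rightarrow> (real \<Rightarrow> real) \<Rightarrow> nat \<Rightarrow> (nat \<Rightarrow> nat) \<Rightarrow> (nat \<Rightarrow> nat \<Rightarrow> real) \<Rightarrow> real \<Rightarrow> 'a \<Rightarrow> real"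
where
  "ddevd X K m n h y \<omega> = (1 / real m) * (\<Sum>i=1..m. inner_approx X K n h i y \<omega> ^ n i)"

definition target_cdf :: "(real \<Rightarrow> real) \<Rightarrow> nat \<Rightarrow> (nat \<Rightarrow> nat) \<Rightarrow> real \<Rightarrow> real" where
  "target_cdf FX m n y = (1 / real m) * (\<Sum>i=1..m. FX y ^ n i)"

definition ddevd_mse where
  "ddevd_mse M X FX K m n h y = (\<integral>\<omega>. (ddevd X K m n h y \<omega> - target_cdf FX m n y)\<^sup>2 \<partial>M)"

definition block_moment where
  "block_moment M X K n h i y N = (\<integral>\<omega>. inner_approx X K n h i y \<omega> ^ N \<partial>M)"

definition block_central_moment where
  "block_central_moment M X K n h i y k =
     (\<integral>\<omega>. (inner_approx X K n h i y \<omega> - (\<integral>\<omega>'. inner_approx X K n h i y \<omega>' \<partial>M)) ^ k \<partial>M)"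

definition block_bias where
  "block_bias M X FX K n h i y = (\<integral>\<omega>. inner_approx X K n h i y \<omega> ^ n i \<partial>M) - FX y ^ n i"

definition block_variance where
  "block_variance M X K n h i y = prob_space.variance M (\<lambda>\<omega>. inner_approx X K n h i y \<omega> ^ n i)"


section \<open>Replacing central moments by normal ones\<close>

definition normal_central_moment :: "real \<Rightarrow> nat \<Rightarrow> real" where
  "normal_central_moment v k = (\<integral>z. (sqrt v * z) ^ k \<partial>std_normal_distribution)"

text \<open>Deviation of the \<open>k\<close>-th central moment of \<open>F\<^sub>i\<^sub>,\<^sub>h(y)\<close> from that of a centred normal variable with
  the same variance.\<close>

definition moment_defect where
  "moment_defect M X K n i y k h =
     block_central_moment M X K n h i y k
       - normal_central_moment (prob_space.variance M (inner_approx X K n h i y)) k"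

text \<open>The binomial expansion of \<open>E[F\<^sub>i\<^sub>,\<^sub>h(y)\<^sup>N]\<close> around \<open>E[F\<^sub>i\<^sub>,\<^sub>h(y)]\<close> with normal central moments, and
  the bias, variance and mean squared error computed from it.  For fixed \<open>n i\<close> the replacement is
  not exact in the limit of vanishing bandwidths (except for \<open>N \<le> 2\<close>), and the coefficient
  functions below are those of the replaced quantities.\<close>

definition normal_block_moment where
  "normal_block_moment M X K n h i y N =
     (\<Sum>k\<le>N. real (N choose k) * (\<integral>\<omega>. inner_approx X K n h i y \<omega> \<partial>M) ^ (N - k)
        * normal_central_moment (prob_space.variance M (inner_approx X K n h i y)) k)"

definition normal_block_bias where
  "normal_block_bias M X FX K n h i y = normal_block_moment M X K n h i y (n i) - FX y ^ n i"

definition normal_block_variance where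
  "normal_block_variance M X K n h i y =
     normal_block_moment M X K n h i y (2 * n i) - (normal_block_moment M X K n h i y (n i))\<^sup>2"

definition normal_mse where
  "normal_mse M X FX K m n h y =
     ((1 / real m) * (\<Sum>i=1..m. normal_block_bias M X FX K n h i y))\<^sup>2
     + (1 / (real m)\<^sup>2) * (\<Sum>i=1..m. normal_block_variance M X K n h i y)"


section \<open>Coefficients\<close>

text \<open>\<open>\<nu>\<close> is the block size \<open>n\<^sub>i\<close>.  Wherever a natural-number subtraction in an exponent or index could
  truncate, the summation range is empty or the binomial coefficient is zero (for \<open>N \<ge> 1\<close>).\<close>

definition coeff_alpha :: "(real \<Rightarrow> real) \<Rightarrow> (real \<Rightarrow> real) \<Rightarrow> real \<Rightarrow> real" where
  "coeff_alpha FX K y =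
     deriv FX y * kernel_moment (ksq K) 1 - 2 * FX y * deriv FX y * kernel_moment K 1"

definition coeff_beta :: "(real \<Rightarrow> real) \<Rightarrow> (real \<Rightarrow> real) \<Rightarrow> real \<Rightarrow> real" where
  "coeff_beta FX K y =
     1/2 * deriv (deriv FX) y * kernel_moment (ksq K) 2
     - deriv (deriv FX) y * FX y * kernel_moment K 2
     - (deriv FX y)\<^sup>2 * (kernel_moment K 1)\<^sup>2"

text \<open>\<open>odd_dfact k = (2k - 1)!!\<close>\<close>

definition odd_dfact :: "nat \<Rightarrow> real" where
  "odd_dfact k = (\<Prod>l=1..k. 2 * real l - 1)"

definition coeff_Y0 :: "(real \<Rightarrow> real) \<Rightarrow> real \<Rightarrow> nat \<Rightarrow> nat \<Rightarrow> real" where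
  "coeff_Y0 FX y \<nu> N =
     (\<Sum>k=0..N div 2. real (N choose (2*k)) * odd_dfact k * (1 / real \<nu> ^ k)
        * FX y ^ (N - k) * (1 - FX y) ^ k)"

definition coeff_Y1 :: "(real \<Rightarrow> real) \<Rightarrow> (real \<Rightarrow> real) \<Rightarrow> real \<Rightarrow> nat \<Rightarrow> nat \<Rightarrow> real" where
  "coeff_Y1 FX K y \<nu> N =
     - (\<Sum>k=1..N div 2. real k * real (N choose (2*k)) * odd_dfact k * (1 / real \<nu> ^ k)
          * FX y ^ (N - k - 1) * (1 - FX y) ^ (k - 1) * coeff_alpha FX K y)"

definition coeff_Y2\<alpha> :: "(real \<Rightarrow> real) \<Rightarrow> (real \<Rightarrow> real) \<Rightarrow> real \<Rightarrow> nat \<Rightarrow> nat \<Rightarrow> real" where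
  "coeff_Y2\<alpha> FX K y \<nu> N =
     (\<Sum>k=2..N div 2. real (N choose (2*k)) * odd_dfact k * (real k * (real k - 1) / (2 * real \<nu> ^ k))
        * FX y ^ (N - k - 2) * (1 - FX y) ^ (k - 2) * (coeff_alpha FX K y)\<^sup>2)"

definition coeff_Y2\<beta> :: "(real \<Rightarrow> real) \<Rightarrow> (real \<Rightarrow> real) \<Rightarrow> real \<Rightarrow> nat \<Rightarrow> nat \<Rightarrow> real" where
  "coeff_Y2\<beta> FX K y \<nu> N =
     (\<Sum>k=1..N div 2. real (N choose (2*k)) * odd_dfact k * (real k / real \<nu> ^ k)
        * FX y ^ (N - k - 1) * (1 - FX y) ^ (k - 1) * coeff_beta FX K y)"

definition coeff_E0 where
  "coeff_E0 FX y \<nu> N = coeff_Y0 FX y \<nu> N"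

definition coeff_E1 where
  "coeff_E1 FX K y \<nu> N =
     coeff_Y1 FX K y \<nu> N - real N * deriv FX y * kernel_moment K 1 * coeff_Y0 FX y \<nu> (N - 1)"

definition coeff_E2a where
  "coeff_E2a FX K y \<nu> N =
     coeff_Y2\<beta> FX K y \<nu> N
     + real N / 2 * deriv (deriv FX) y * kernel_moment K 2 * coeff_Y0 FX y \<nu> (N - 1)"

definition coeff_E2b where
  "coeff_E2b FX K y \<nu> N =
     coeff_Y2\<alpha> FX K y \<nu> N
     - real N * deriv FX y * kernel_moment K 1 * coeff_Y1 FX K y \<nu> (N - 1)
     + real (N choose 2) * (deriv FX y)\<^sup>2 * (kernel_moment K 1)\<^sup>2 * coeff_Y0 FX y \<nu> (N - 2)"

definition coeff_b0 where
  "coeff_b0 FX y \<nu> = coeff_E0 FX y \<nu> \<nu> - FX y ^ \<nu>"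

definition coeff_b1 where
  "coeff_b1 FX K y \<nu> = coeff_E1 FX K y \<nu> \<nu>"

definition coeff_b2a where
  "coeff_b2a FX K y \<nu> = coeff_E2a FX K y \<nu> \<nu>"

definition coeff_b2b where
  "coeff_b2b FX K y \<nu> = coeff_E2b FX K y \<nu> \<nu>"

definition coeff_V0 where
  "coeff_V0 FX y \<nu> = coeff_E0 FX y \<nu> (2 * \<nu>) - (coeff_E0 FX y \<nu> \<nu>)\<^sup>2"

definition coeff_V1 where
  "coeff_V1 FX K y \<nu> =
     coeff_E1 FX K y \<nu> (2 * \<nu>) - 2 * coeff_E0 FX y \<nu> \<nu> * coeff_E1 FX K y \<nu> \<nu>"

definition coeff_V2a where
  "coeff_V2a FX K y \<nu> =
     coeff_E2a FX K y \<nu> (2 * \<nu>) - 2 * coeff_E0 FX y \<nu> \<nu> * coeff_E2a FX K y \<nu> \<nu>"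

definition coeff_V2b where
  "coeff_V2b FX K y \<nu> =
     coeff_E2b FX K y \<nu> (2 * \<nu>) - 2 * coeff_E0 FX y \<nu> \<nu> * coeff_E2b FX K y \<nu> \<nu>
     - (coeff_E1 FX K y \<nu> \<nu>)\<^sup>2"


section \<open>Expansions in the bandwidths\<close>

definition hbar :: "(nat \<Rightarrow> nat) \<Rightarrow> (nat \<Rightarrow> nat \<Rightarrow> real) \<Rightarrow> nat \<Rightarrow> real" where
  "hbar n h i = (1 / real (n i)) * (\<Sum>j=1..n i. h i j)"

definition h2bar :: "(nat \<Rightarrow> nat) \<Rightarrow> (nat \<Rightarrow> nat \<Rightarrow> real) \<Rightarrow> nat \<Rightarrow> real" where
  "h2bar n h i = (1 / real (n i)) * (\<Sum>j=1..n i. (h i j)\<^sup>2)"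

definition bias_expansion where
  "bias_expansion FX K n h i y =
     coeff_b0 FX y (n i) + hbar n h i * coeff_b1 FX K y (n i)
     + h2bar n h i * coeff_b2a FX K y (n i) + (hbar n h i)\<^sup>2 * coeff_b2b FX K y (n i)"

definition variance_expansion where
  "variance_expansion FX K n h i y =
     coeff_V0 FX y (n i) + hbar n h i * coeff_V1 FX K y (n i)
     + h2bar n h i * coeff_V2a FX K y (n i) + (hbar n h i)\<^sup>2 * coeff_V2b FX K y (n i)"

definition mse_expansion where
  "mse_expansion FX K m n h y =
     1 / (real m)\<^sup>2 * ((\<Sum>i=1..m. coeff_b0 FX y (n i))\<^sup>2 + (\<Sum>i=1..m. coeff_V0 FX y (n i)))
   + 1 / (real m)\<^sup>2 *
       (2 * (\<Sum>i=1..m. coeff_b0 FX y (n i)) * (\<Sum>i=1..m. hbar n h i * coeff_b1 FX K y (n i))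
        + (\<Sum>i=1..m. hbar n h i * coeff_V1 FX K y (n i)))
   + 1 / (real m)\<^sup>2 *
       ((\<Sum>i=1..m. hbar n h i * coeff_b1 FX K y (n i))\<^sup>2
        + 2 * (\<Sum>i=1..m. coeff_b0 FX y (n i))
            * ((\<Sum>i=1..m. h2bar n h i * coeff_b2a FX K y (n i))
               + (\<Sum>i=1..m. (hbar n h i)\<^sup>2 * coeff_b2b FX K y (n i)))
        + (\<Sum>i=1..m. h2bar n h i * coeff_V2a FX K y (n i) + (hbar n h i)\<^sup>2 * coeff_V2b FX K y (n i)))"

definition pos_bandwidths :: "nat \<Rightarrow> (nat \<Rightarrow> nat) \<Rightarrow> (nat \<Rightarrow> nat \<Rightarrow> real) set" where
  "pos_bandwidths m n = {h. \<forall>(i, j)\<in>block_indices m n. 0 < h i j}"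

definition bw_size :: "nat \<Rightarrow> (nat \<Rightarrow> nat) \<Rightarrow> (nat \<Rightarrow> nat \<Rightarrow> real) \<Rightarrow> real" where
  "bw_size m n h = (MAX (i, j)\<in>block_indices m n. h i j)"

text \<open>All bandwidths tend to \<open>0\<close> jointly through positive values, with \<open>m\<close> and the \<open>n i\<close> fixed and
  without any restriction on their relative sizes.\<close>

definition bw_to_0 :: "nat \<Rightarrow> (nat \<Rightarrow> nat) \<Rightarrow> (nat \<Rightarrow> nat \<Rightarrow> real) filter" where
  "bw_to_0 m n = inf (filtercomap (bw_size m n) (at_right 0)) (principal (pos_bandwidths m n))"

text \<open>The meaning of \<open>O(h\<^sup>3)\<close>.  With \<open>F\<^sub>X\<close> only twice continuously differentiable and only second kernel
  moments, the remainder is of higher than second order, \<open>o(|h|\<^sup>2)\<close>; the literal \<open>O(|h|\<^sup>3)\<close> needs one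
  more derivative and third moments.\<close>

definition remainder ::
  "(real \<Rightarrow> real) \<Rightarrow> (real \<Rightarrow> real) \<Rightarrow> nat \<Rightarrow> (nat \<Rightarrow> nat) \<Rightarrow> ((nat \<Rightarrow> nat \<Rightarrow> real) \<Rightarrow> real) set"
where
  "remainder FX K m n =
     (if C_diff 3 FX \<and> has_kernel_moment K 3 \<and> has_kernel_moment (ksq K) 3
      then O[bw_to_0 m n](\<lambda>h. bw_size m n h ^ 3)
      else o[bw_to_0 m n](\<lambda>h. (bw_size m n h)\<^sup>2))"

end

(*
  Let U have the distribution described by the kernel, independently of X.  Since F_X is continuous,
  E K((y - X)/t) = P(X + t U <= y) = E F_X(y - t U), and likewise for K^2, whose distribution has its
  own moments.  Taylor expansion of F_X at y under the integral gives the expansion of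
  these means in t; the rest is o(t^2) by dominated convergence, and O(t^3) under the stronger
  hypotheses.  By independence this yields second order expansions of the mean and the variance of
  F_{i,h}(y).  The normal moments of even order are polynomials in the mean and the variance, and
  second order expansions are closed under the ring operations, so the coefficients are found by
  multiplying out.
*)
theory Submission
  imports Defs
begin

text \<open>The bandwidths form a whole array, so an expansion is not a polynomial in one parameter:
  its linear and quadratic parts are functions of \<open>h\<close>, measured against the largest
  bandwidth. At second order two functions appear. \<open>h2bar\<close> collects the quadratic terms
  of single observations, while the square of \<open>hbar\<close> comes from multiplying two
  averaged linear terms. The remainder is either \<open>O(s^3)\<close> or \<open>o(s^2)\<close>,
  depending on the regularity at hand; all algebra is done once, from properties common to both. A
  kernel may jump, and at a jump it need not equal its right limit. The kernel and the distribution
  function of \<open>U\<close> therefore agree only off a countable set, which continuity of F_X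
  makes negligible. The normal replacement is exact for the central moments of order 0, 1 and 2. For
  fixed block sizes the defects of higher order need not vanish with the bandwidths, so statements
  about the exact bias, variance and squared error carry smallness of these defects as a
  premise.\<close>

section \<open>Second-order expansions\<close>

text \<open>What \<open>O(s^3)\<close> and \<open>o(s^2)\<close> have in common: an additive class,
  closed under domination, that lies between \<open>O(s^3)\<close> and \<open>O(s^2)\<close>. The
  lower bound absorbs products of linear with quadratic terms, the upper bound keeps expanded
  functions bounded.\<close>

locale second_order_remainder =
  fixes F :: "'b filter" and s :: "'b \<Rightarrow> real" and R :: "('b \<Rightarrow> real) set"
  assumes scale_to_0: "(s \<longlongrightarrow> 0) F"
    and R_add: "\<And>f g. f \<in> R \<Longrightarrow> g \<in> R \<Longrightarrow> (\<lambda>x. f x + g x) \<in> R"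
    and R_bigo: "\<And>f g. f \<in> R \<Longrightarrow> g \<in> O[F](f) \<Longrightarrow> g \<in> R"
    and R_quadratic: "\<And>f. f \<in> R \<Longrightarrow> f \<in> O[F](\<lambda>x. (s x)\<^sup>2)"
    and R_cubic: "\<And>f. f \<in> O[F](\<lambda>x. s x ^ 3) \<Longrightarrow> f \<in> R"
begin

lemma scale_bigo_1: "s \<in> O[F](\<lambda>_. 1)"
  by (rule bigoI_tendsto[where c = 0]) (use scale_to_0 in simp_all)

lemma bigo_bounded_mult:
  assumes "f \<in> O[F](\<lambda>_. 1)" "g \<in> O[F](k)"
  shows "(\<lambda>x. f x * g x) \<in> O[F](k)"
  using landau_o.big.mult[OF assms] by simp

lemma scale2_bigo_1: "(\<lambda>x. (s x)\<^sup>2) \<in> O[F](\<lambda>_. 1)"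
  using landau_o.big.mult[OF scale_bigo_1 scale_bigo_1] by (simp add: power2_eq_square)

lemma bigo_1_of_bigo_scale: "f \<in> O[F](s) \<Longrightarrow> f \<in> O[F](\<lambda>_. 1)"
  using landau_o.big_trans scale_bigo_1 by blast

lemma bigo_1_of_bigo_scale2: "f \<in> O[F](\<lambda>x. (s x)\<^sup>2) \<Longrightarrow> f \<in> O[F](\<lambda>_. 1)"
  using landau_o.big_trans scale2_bigo_1 by blast

lemma R_0: "(\<lambda>_. 0) \<in> R"
  by (rule R_cubic) simp

lemma R_mult: "f \<in> O[F](\<lambda>_. 1) \<Longrightarrow> g \<in> R \<Longrightarrow> (\<lambda>x. f x * g x) \<in> R"
  by (rule R_bigo, assumption, rule bigo_bounded_mult) auto

lemma R_sum:
  assumes "\<And>i. i \<in> I \<Longrightarrow> f i \<in> R"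
  shows "(\<lambda>x. \<Sum>i\<in>I. f i x) \<in> R"
  using assms by (induction I rule: infinite_finite_induct) (auto intro: R_0 R_add)

lemma R_cong: "eventually (\<lambda>x. f x = g x) F \<Longrightarrow> f \<in> R \<Longrightarrow> g \<in> R"
  by (erule R_bigo, rule bigoI[where c = 1], erule eventually_mono) simp

text \<open>The two O-bounds record the orders of \<open>b\<close> and \<open>c\<close>, which is
  what allows the terms of a product to be sorted. The parts are determined only up to
  \<open>R\<close>.\<close>

definition has_expansion :: "('b \<Rightarrow> real) \<Rightarrow> real \<Rightarrow> ('b \<Rightarrow> real) \<Rightarrow> ('b \<Rightarrow> real) \<Rightarrow> bool" where
  "has_expansion g a b c \<longleftrightarrow>
     b \<in> O[F](s) \<and> c \<in> O[F](\<lambda>x. (s x)\<^sup>2) \<and> (\<lambda>x. g x - (a + b x + c x)) \<in> R"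

lemma has_expansion_bigo_1:
  assumes "has_expansion g a b c"
  shows "g \<in> O[F](\<lambda>_. 1)"
proof -
  have b: "b \<in> O[F](\<lambda>_. 1)" and c: "c \<in> O[F](\<lambda>_. 1)"
    and r: "(\<lambda>x. g x - (a + b x + c x)) \<in> O[F](\<lambda>_. 1)"
    using assms bigo_1_of_bigo_scale bigo_1_of_bigo_scale2 R_quadratic
    by (auto simp: has_expansion_def)
  have "(\<lambda>x. (g x - (a + b x + c x)) + (a + b x + c x)) \<in> O[F](\<lambda>_. 1)"
    by (intro sum_in_bigo b c r) auto
  then show ?thesis by simp
qed

lemma has_expansion_const: "has_expansion (\<lambda>_. a) a (\<lambda>_. 0) (\<lambda>_. 0)"
  by (simp add: has_expansion_def R_0)

lemma has_expansion_add:
  assumes "has_expansion g a b c" "has_expansion g' a' b' c'"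
  shows "has_expansion (\<lambda>x. g x + g' x) (a + a') (\<lambda>x. b x + b' x) (\<lambda>x. c x + c' x)"
proof -
  have "(\<lambda>x. g x + g' x - (a + a' + (b x + b' x) + (c x + c' x)))
      = (\<lambda>x. (g x - (a + b x + c x)) + (g' x - (a' + b' x + c' x)))"
    by (simp add: algebra_simps)
  then show ?thesis
    using assms by (auto simp: has_expansion_def intro: sum_in_bigo R_add)
qed

lemma has_expansion_mult:
  assumes g: "has_expansion g a b c" and g': "has_expansion g' a' b' c'"
  shows "has_expansion (\<lambda>x. g x * g' x) (a * a') (\<lambda>x. a * b' x + b x * a')
           (\<lambda>x. a * c' x + b x * b' x + c x * a')"
proof -
  have b: "b \<in> O[F](s)" "b' \<in> O[F](s)" and c: "c \<in> O[F](\<lambda>x. (s x)\<^sup>2)" "c' \<in> O[F](\<lambda>x. (s x)\<^sup>2)"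
    and r: "(\<lambda>x. g x - (a + b x + c x)) \<in> R" "(\<lambda>x. g' x - (a' + b' x + c' x)) \<in> R"
    using g g' by (auto simp: has_expansion_def)
  have bb: "(\<lambda>x. b x * b' x) \<in> O[F](\<lambda>x. (s x)\<^sup>2)"
    using landau_o.big.mult[OF b] by (simp add: power2_eq_square)
  have bc: "(\<lambda>x. b x * c' x) \<in> O[F](\<lambda>x. s x ^ 3)" "(\<lambda>x. b' x * c x) \<in> O[F](\<lambda>x. s x ^ 3)"
    using landau_o.big.mult[OF b(1) c(2)] landau_o.big.mult[OF b(2) c(1)]
    by (simp_all add: power2_eq_square power3_eq_cube mult.assoc)
  have "(\<lambda>x. c x * c' x) \<in> O[F](\<lambda>x. (s x)\<^sup>2 * (s x)\<^sup>2)"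
    by (rule landau_o.big.mult[OF c])
  moreover have "(\<lambda>x. s x * s x ^ 3) \<in> O[F](\<lambda>x. s x ^ 3)"
    by (rule bigo_bounded_mult[OF scale_bigo_1]) simp
  ultimately have cc: "(\<lambda>x. c x * c' x) \<in> O[F](\<lambda>x. s x ^ 3)"
    by (auto simp: power2_eq_square power3_eq_cube mult.assoc intro: landau_o.big_trans)
  \<comment> \<open>With \<open>P\<close> and \<open>P'\<close> for the expanded parts,
    \<open>g g' - P P' = g' (g - P) + P (g' - P')\<close>. Cutting \<open>P P'\<close> off after
    second order drops exactly \<open>b c' + b' c + c c'\<close>, which has order three at
    least.\<close>
  have "(\<lambda>x. g' x * (g x - (a + b x + c x))) \<in> R"
    by (rule R_mult[OF has_expansion_bigo_1[OF g'] r(1)])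
  moreover have "(\<lambda>x. (a + b x + c x) * (g' x - (a' + b' x + c' x))) \<in> R"
    by (intro R_mult[OF _ r(2)] sum_in_bigo bigo_1_of_bigo_scale[OF b(1)] bigo_1_of_bigo_scale2[OF c(1)]) auto
  moreover have "(\<lambda>x. b x * c' x + b' x * c x + c x * c' x) \<in> R"
    by (intro R_cubic sum_in_bigo bc cc)
  ultimately have "(\<lambda>x. g' x * (g x - (a + b x + c x)) + (a + b x + c x) * (g' x - (a' + b' x + c' x))
      + (b x * c' x + b' x * c x + c x * c' x)) \<in> R"
    by (rule R_add[OF R_add])
  moreover have "(\<lambda>x. g' x * (g x - (a + b x + c x)) + (a + b x + c x) * (g' x - (a' + b' x + c' x))
      + (b x * c' x + b' x * c x + c x * c' x))
      = (\<lambda>x. g x * g' x - (a * a' + (a * b' x + b x * a') + (a * c' x + b x * b' x + c x * a')))"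
    by (simp add: fun_eq_iff algebra_simps)
  ultimately have "(\<lambda>x. g x * g' x - (a * a' + (a * b' x + b x * a') + (a * c' x + b x * b' x + c x * a'))) \<in> R"
    by simp
  moreover have "(\<lambda>x. a * b' x + b x * a') \<in> O[F](s)"
    unfolding mult.commute[of _ a'] by (intro sum_in_bigo bigo_bounded_mult b) auto
  moreover have "(\<lambda>x. a * c' x + b x * b' x + c x * a') \<in> O[F](\<lambda>x. (s x)\<^sup>2)"
    unfolding mult.commute[of _ a'] by (intro sum_in_bigo bb bigo_bounded_mult[OF _ c(1)] bigo_bounded_mult[OF _ c(2)]) auto
  ultimately show ?thesis
    by (simp add: has_expansion_def)
qed

lemma has_expansion_cmult:
  assumes "has_expansion g a b c"
  shows "has_expansion (\<lambda>x. k * g x) (k * a) (\<lambda>x. k * b x) (\<lambda>x. k * c x)"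
  using has_expansion_mult[OF has_expansion_const[of k] assms] by simp

lemma has_expansion_diff:
  assumes "has_expansion g a b c" "has_expansion g' a' b' c'"
  shows "has_expansion (\<lambda>x. g x - g' x) (a - a') (\<lambda>x. b x - b' x) (\<lambda>x. c x - c' x)"
  using has_expansion_add[OF assms(1) has_expansion_cmult[OF assms(2), of "- 1"]] by simp

lemma has_expansion_sum:
  assumes "\<And>i. i \<in> I \<Longrightarrow> has_expansion (g i) (a i) (b i) (c i)"
  shows "has_expansion (\<lambda>x. \<Sum>i\<in>I. g i x) (\<Sum>i\<in>I. a i) (\<lambda>x. \<Sum>i\<in>I. b i x) (\<lambda>x. \<Sum>i\<in>I. c i x)"
  using assms
  by (induction I rule: infinite_finite_induct) (auto intro: has_expansion_const has_expansion_add)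

text \<open>The factors are the first two Taylor coefficients of \<open>x^N\<close> at
  \<open>a\<close>. Where \<open>N - 1\<close> or \<open>N - 2\<close> truncates, the factor
  \<open>N\<close> or \<open>N choose 2\<close> is zero.\<close>

lemma has_expansion_power:
  assumes "has_expansion g a b c"
  shows "has_expansion (\<lambda>x. g x ^ N) (a ^ N) (\<lambda>x. real N * a ^ (N - 1) * b x)
           (\<lambda>x. real N * a ^ (N - 1) * c x + real (N choose 2) * a ^ (N - 2) * (b x)\<^sup>2)"
proof (induction N)
  case 0
  then show ?case using has_expansion_const[of 1] by (simp add: binomial_eq_0)
next
  case (Suc N)
  have 1: "a ^ N * b x + real N * a ^ (N - 1) * b x * a = real (Suc N) * a ^ N * b x" for x
    by (cases N) (auto simp: algebra_simps)
  have 2: "a ^ N * c x + real N * a ^ (N - 1) * b x * b x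
         + (real N * a ^ (N - 1) * c x + real (N choose 2) * a ^ (N - 2) * (b x)\<^sup>2) * a
       = real (Suc N) * a ^ N * c x + real (Suc N choose 2) * a ^ (N - 1) * (b x)\<^sup>2" for x
  proof -
    consider "N = 0" | "N = 1" | k where "N = Suc (Suc k)"
      by (metis One_nat_def old.nat.exhaust)
    then show ?thesis
      by cases (auto simp: algebra_simps power2_eq_square numeral_2_eq_2)
  qed
  show ?case
    using has_expansion_mult[OF Suc.IH assms] unfolding 1 2 by (simp add: mult.commute)
qed

text \<open>Brings a composed expansion into the wanted form. The expanded function may change off
  an eventual set, because the means and variances are computed for positive bandwidths
  only.\<close>

lemma has_expansion_eq:
  assumes "has_expansion g a b c" "a = a'" "\<And>x. b x = b' x" "\<And>x. c x = c' x"
    "eventually (\<lambda>x. g x = g' x) F"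
  shows "has_expansion g' a' b' c'"
proof -
  have "b = b'" "c = c'" using assms by auto
  moreover have "(\<lambda>x. g' x - (a + b x + c x)) \<in> R"
  proof (rule R_cong)
    show "\<forall>\<^sub>F x in F. g x - (a + b x + c x) = g' x - (a + b x + c x)"
      using assms(5) by (rule eventually_mono) simp
  qed (use assms(1) in \<open>simp add: has_expansion_def\<close>)
  ultimately show ?thesis
    using assms by (simp add: has_expansion_def)
qed

end

section \<open>Normal moments\<close>

lemma odd_dfact_Suc: "odd_dfact (Suc k) = (2 * real k + 1) * odd_dfact k"
  by (simp add: odd_dfact_def)

text \<open>Even normal moments are integrated as \<open>(2k)! / (2^k k!)\<close>; this identity
  turns that value into the double factorial of the coefficients.\<close>

lemma fact_double_eq_odd_dfact: "fact (2 * k) = odd_dfact k * (2 ^ k * fact k)"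
proof (induction k)
  case 0
  then show ?case by (simp add: odd_dfact_def)
next
  case (Suc k)
  have "fact (2 * Suc k) = (2 * real k + 2) * ((2 * real k + 1) * fact (2 * k))"
    by (simp add: algebra_simps)
  then show ?case
    unfolding Suc.IH odd_dfact_Suc by (simp add: algebra_simps)
qed

lemma normal_central_moment_eq:
  "normal_central_moment v k = sqrt v ^ k * (\<integral>x. std_normal_density x * x ^ k \<partial>lborel)"
proof -
  have "normal_central_moment v k = (\<integral>x. std_normal_density x * (sqrt v * x) ^ k \<partial>lborel)"
    unfolding normal_central_moment_def by (subst integral_density) auto
  also have "\<dots> = (\<integral>x. sqrt v ^ k * (std_normal_density x * x ^ k) \<partial>lborel)"
    by (simp add: power_mult_distrib mult.left_commute)
  finally show ?thesis by simp
qed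

lemma normal_central_moment_odd: "odd k \<Longrightarrow> normal_central_moment v k = 0"
  using integral_std_normal_moment_odd by (auto simp: normal_central_moment_eq elim!: oddE)

text \<open>The square root disappears, so the replaced moments are polynomials in mean and variance
  and the ring rules for expansions suffice, even where the variance tends to 0.\<close>

lemma normal_central_moment_even:
  assumes "0 \<le> v"
  shows "normal_central_moment v (2 * k) = v ^ k * odd_dfact k"
  unfolding normal_central_moment_eq integral_std_normal_moment_even fact_double_eq_odd_dfact
  using assms by (simp add: power_mult)

text \<open>The upper limit stays \<open>N\<close> instead of \<open>N div 2\<close>: the additional
  summands vanish, and the range is free of floors.\<close>

lemma sum_even_indices:
  fixes f :: "nat \<Rightarrow> real"
  assumes "\<And>k. odd k \<Longrightarrow> f k = 0" "\<And>k. N < k \<Longrightarrow> f k = 0"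
  shows "(\<Sum>k\<le>N. f k) = (\<Sum>k\<le>N. f (2 * k))"
proof -
  have "(\<Sum>k\<le>N. f k) = (\<Sum>k\<le>2 * N. f k)"
    by (rule sum.mono_neutral_left) (use assms(2) in auto)
  also have "\<dots> = sum f ((\<lambda>k. 2 * k) ` {..N})"
  proof (rule sum.mono_neutral_right)
    show "\<forall>k\<in>{..2 * N} - (\<lambda>k. 2 * k) ` {..N}. f k = 0"
      using assms(1) by (fastforce elim: evenE)
  qed auto
  also have "\<dots> = (\<Sum>k\<le>N. f (2 * k))"
    by (subst sum.reindex) (auto simp: inj_on_def)
  finally show ?thesis .
qed

lemma normal_moment_sum:
  assumes "0 \<le> v"
  shows "(\<Sum>k\<le>N. real (N choose k) * \<mu> ^ (N - k) * normal_central_moment v k)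
       = (\<Sum>k\<le>N. real (N choose (2 * k)) * odd_dfact k * (\<mu> ^ (N - 2 * k) * v ^ k))"
proof (subst sum_even_indices)
  show "(\<Sum>k\<le>N. real (N choose (2 * k)) * \<mu> ^ (N - 2 * k) * normal_central_moment v (2 * k))
      = (\<Sum>k\<le>N. real (N choose (2 * k)) * odd_dfact k * (\<mu> ^ (N - 2 * k) * v ^ k))"
    unfolding normal_central_moment_even[OF assms] by (simp only: ac_simps)
qed (auto simp: normal_central_moment_odd binomial_eq_0)

section \<open>The coefficient functions\<close>

text \<open>With \<open>w = F\<^sub>X (1 - F\<^sub>X) / \<nu>\<close>, the summation range can be enlarged to any common bound \<open>B\<close>, which
  makes the sums for \<open>N\<close>, \<open>N - 1\<close> and \<open>N - 2\<close> comparable term by term.\<close>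

lemma sum_half_range:
  fixes f :: "nat \<Rightarrow> real"
  assumes "N \<le> B" "\<And>k. k < l \<Longrightarrow> f k = 0" "\<And>k. N < 2 * k \<Longrightarrow> f k = 0"
    "\<And>k. l \<le> k \<Longrightarrow> 2 * k \<le> N \<Longrightarrow> g k = f k"
  shows "(\<Sum>k=l..N div 2. g k) = (\<Sum>k\<le>B. f k)"
proof -
  have "(\<Sum>k=l..N div 2. g k) = (\<Sum>k=l..N div 2. f k)"
    by (intro sum.cong refl assms(4)) auto
  also have "\<dots> = (\<Sum>k\<le>B. f k)"
    using assms(1-3) by (intro sum.mono_neutral_left) auto
  finally show ?thesis .
qed

context
  fixes FX K :: "real \<Rightarrow> real" and y :: real and \<nu> :: nat and w :: real
  assumes \<nu>: "0 < \<nu>" and w: "w = FX y * (1 - FX y) / real \<nu>"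
begin

lemma coeff_Y0_eq:
  assumes "N \<le> B"
  shows "coeff_Y0 FX y \<nu> N = (\<Sum>k\<le>B. real (N choose (2 * k)) * odd_dfact k * (FX y ^ (N - 2 * k) * w ^ k))"
  unfolding coeff_Y0_def
proof (rule sum_half_range[OF assms])
  fix k assume "2 * k \<le> N"
  then have "N - k = (N - 2 * k) + k" by simp
  then show "real (N choose (2*k)) * odd_dfact k * (1 / real \<nu> ^ k) * FX y ^ (N - k) * (1 - FX y) ^ k
      = real (N choose (2 * k)) * odd_dfact k * (FX y ^ (N - 2 * k) * w ^ k)"
    by (simp only: power_add) (simp add: w power_divide power_mult_distrib)
qed (auto simp: binomial_eq_0)

text \<open>Differentiating \<open>w^k\<close> loses one factor \<open>FX y * (1 - FX y)\<close> but
  keeps all \<open>k\<close> factors \<open>1 / \<nu>\<close>, the last one being supplied by the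
  division. The bound \<open>2 * k \<le> N\<close> prevents the subtractions from
  truncating.\<close>

lemma scaled_power_pred:
  assumes "1 \<le> k" "2 * k \<le> N"
  shows "FX y ^ (N - 2 * k) * w ^ (k - 1) / real \<nu> = FX y ^ (N - k - 1) * (1 - FX y) ^ (k - 1) / real \<nu> ^ k"
proof -
  from assms have "N - k - 1 = (N - 2 * k) + (k - 1)" by simp
  moreover have "real \<nu> ^ k = real \<nu> ^ (k - 1) * real \<nu>"
    using assms by (metis One_nat_def Suc_pred less_eq_Suc_le power_Suc2)
  ultimately show ?thesis
    by (simp only: power_add) (simp add: w power_divide power_mult_distrib)
qed

text \<open>\<open>coeff_Y1\<close> is the linear change of \<open>coeff_Y0\<close> when only the
  variance moves: \<open>k * w ^ (k - 1)\<close> is the derivative of \<open>w ^ k\<close>, and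
  minus \<open>coeff_alpha\<close> over \<open>\<nu>\<close> is the rate of change of the variance.
  The next two lemmas treat second order likewise, \<open>coeff_beta\<close> being the quadratic
  change of the variance and \<open>k choose 2\<close> the second Taylor coefficient of
  \<open>w ^ k\<close>.\<close>

lemma coeff_Y1_eq:
  assumes "N \<le> B"
  shows "coeff_Y1 FX K y \<nu> N = - (\<Sum>k\<le>B. real (N choose (2 * k)) * odd_dfact k
           * (FX y ^ (N - 2 * k) * (real k * w ^ (k - 1) * (coeff_alpha FX K y / real \<nu>))))"
  unfolding coeff_Y1_def neg_equal_iff_equal
proof (rule sum_half_range[OF assms])
  fix k assume k: "1 \<le> k" "2 * k \<le> N"
  show "real k * real (N choose (2*k)) * odd_dfact k * (1 / real \<nu> ^ k)
          * FX y ^ (N - k - 1) * (1 - FX y) ^ (k - 1) * coeff_alpha FX K y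
      = real (N choose (2 * k)) * odd_dfact k
           * (FX y ^ (N - 2 * k) * (real k * w ^ (k - 1) * (coeff_alpha FX K y / real \<nu>)))"
    using arg_cong[OF scaled_power_pred[OF k], of "\<lambda>x. real k * real (N choose (2*k)) * odd_dfact k * coeff_alpha FX K y * x"]
    by (simp add: ac_simps)
qed (auto simp: binomial_eq_0)

lemma coeff_Y2\<beta>_eq:
  assumes "N \<le> B"
  shows "coeff_Y2\<beta> FX K y \<nu> N = (\<Sum>k\<le>B. real (N choose (2 * k)) * odd_dfact k
           * (FX y ^ (N - 2 * k) * (real k * w ^ (k - 1) * (coeff_beta FX K y / real \<nu>))))"
  unfolding coeff_Y2\<beta>_def
proof (rule sum_half_range[OF assms])
  fix k assume k: "1 \<le> k" "2 * k \<le> N"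
  show "real (N choose (2*k)) * odd_dfact k * (real k / real \<nu> ^ k)
          * FX y ^ (N - k - 1) * (1 - FX y) ^ (k - 1) * coeff_beta FX K y
      = real (N choose (2 * k)) * odd_dfact k
           * (FX y ^ (N - 2 * k) * (real k * w ^ (k - 1) * (coeff_beta FX K y / real \<nu>)))"
    using arg_cong[OF scaled_power_pred[OF k], of "\<lambda>x. real k * real (N choose (2*k)) * odd_dfact k * coeff_beta FX K y * x"]
    by (simp add: ac_simps)
qed (auto simp: binomial_eq_0)

lemma coeff_Y2\<alpha>_eq:
  assumes "N \<le> B"
  shows "coeff_Y2\<alpha> FX K y \<nu> N = (\<Sum>k\<le>B. real (N choose (2 * k)) * odd_dfact k
           * (FX y ^ (N - 2 * k) * (real (k choose 2) * w ^ (k - 2) * (coeff_alpha FX K y / real \<nu>)\<^sup>2)))"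
  unfolding coeff_Y2\<alpha>_def
proof (rule sum_half_range[OF assms])
  fix k assume k: "2 \<le> k" "2 * k \<le> N"
  from k have "N - k - 2 = (N - 2 * k) + (k - 2)" by simp
  moreover have "real \<nu> ^ k = real \<nu> ^ (k - 2) * (real \<nu>)\<^sup>2"
    using k by (metis le_add_diff_inverse2 power_add)
  moreover have "real (k choose 2) = real k * (real k - 1) / 2"
    using k by (auto simp: choose_two real_of_nat_div of_nat_diff)
  ultimately show "real (N choose (2*k)) * odd_dfact k * (real k * (real k - 1) / (2 * real \<nu> ^ k))
          * FX y ^ (N - k - 2) * (1 - FX y) ^ (k - 2) * (coeff_alpha FX K y)\<^sup>2
      = real (N choose (2 * k)) * odd_dfact k
           * (FX y ^ (N - 2 * k) * (real (k choose 2) * w ^ (k - 2) * (coeff_alpha FX K y / real \<nu>)\<^sup>2))"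
    by (simp only: power_add) (simp add: w power_divide power_mult_distrib ac_simps)
qed (auto simp: binomial_eq_0)

end

text \<open>Differentiating \<open>\<mu> ^ (N - j)\<close> produces the factor \<open>N - j\<close>.
  Absorbed into the binomial coefficient, it turns a sum for \<open>N\<close> into \<open>N\<close>
  times the sum for \<open>N - 1\<close>; this is how index \<open>N - 1\<close> enters the
  coefficients.\<close>

lemma binomial_absorb_diff: "real (N choose j) * real (N - j) = real N * real ((N - 1) choose j)"
proof (cases N)
  case (Suc N')
  then have "(N - j) * (N choose j) = N * (N' choose j)"
    using binomial_absorb_comp[of N j] by simp
  then show ?thesis
    using Suc by (metis diff_Suc_1 mult.commute of_nat_mult)
qed simp

text \<open>Both sides count the disjoint choices of \<open>j\<close> and of 2 among
  \<open>N\<close> elements; the proof passes through the choice of their union. It serves the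
  second derivative in the mean and leads to index \<open>N - 2\<close>.\<close>

lemma binomial_absorb_diff2:
  "real (N choose j) * real ((N - j) choose 2) = real (N choose 2) * real ((N - 2) choose j)"
proof (cases "2 + j \<le> N")
  case True
  have "(N choose j) * ((N - j) choose 2) = (N choose 2) * ((N - 2) choose j)"
  proof -
    have "(N choose (j + 2)) * ((j + 2) choose j) = (N choose j) * ((N - j) choose 2)"
      using choose_mult[of j "j + 2" N] True by simp
    moreover have "(N choose (j + 2)) * ((j + 2) choose 2) = (N choose 2) * ((N - 2) choose j)"
      using choose_mult[of 2 "j + 2" N] True by simp
    moreover have "(j + 2) choose j = (j + 2) choose 2"
      using binomial_symmetric[of j "j + 2"] by simp
    ultimately show ?thesis by simp
  qed
  then show ?thesis by (metis of_nat_mult)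
next
  case False
  then show ?thesis
    by (cases "N < 2") (auto simp: binomial_eq_0)
qed

section \<open>The expansion of the replaced moments\<close>

context second_order_remainder
begin

text \<open>Explains the form of the coefficients: they are the second order Taylor terms of a
  polynomial in \<open>\<mu>\<close> and \<open>v\<close>. Derivatives in \<open>v\<close> give the
  sums \<open>coeff_Y1\<close>, \<open>coeff_Y2\<alpha>\<close> and \<open>coeff_Y2\<beta>\<close>,
  derivatives in \<open>\<mu>\<close> lower the index, and the mixed derivative gives
  \<open>coeff_Y1\<close> at \<open>N - 1\<close>. The functions \<open>h1\<close> and
  \<open>h2\<close> will be \<open>hbar\<close> and \<open>h2bar\<close>.\<close>

lemma has_expansion_normal_moment:
  fixes FX K :: "real \<Rightarrow> real" and y :: real and \<nu> :: nat
  assumes \<nu>: "0 < \<nu>"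
    and mean: "has_expansion \<mu> (FX y) (\<lambda>h. - (deriv FX y * kernel_moment K 1) * h1 h)
                 (\<lambda>h. 1/2 * deriv (deriv FX) y * kernel_moment K 2 * h2 h)"
    and var: "has_expansion v (FX y * (1 - FX y) / real \<nu>) (\<lambda>h. - (coeff_alpha FX K y / real \<nu>) * h1 h)
                 (\<lambda>h. coeff_beta FX K y / real \<nu> * h2 h)"
    and nonneg: "eventually (\<lambda>h. 0 \<le> v h) F"
  shows "has_expansion (\<lambda>h. \<Sum>k\<le>N. real (N choose k) * \<mu> h ^ (N - k) * normal_central_moment (v h) k)
           (coeff_E0 FX y \<nu> N) (\<lambda>h. h1 h * coeff_E1 FX K y \<nu> N)
           (\<lambda>h. h2 h * coeff_E2a FX K y \<nu> N + (h1 h)\<^sup>2 * coeff_E2b FX K y \<nu> N)"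
proof -
  define w where "w = FX y * (1 - FX y) / real \<nu>"
  define g where "g = deriv FX y * kernel_moment K 1"
  define q where "q = 1/2 * deriv (deriv FX) y * kernel_moment K 2"
  define \<alpha> where "\<alpha> = coeff_alpha FX K y / real \<nu>"
  define \<beta> where "\<beta> = coeff_beta FX K y / real \<nu>"
  define C where "C N k = real (N choose (2 * k)) * odd_dfact k" for N k
  note Y = coeff_Y0_eq[of \<nu> w FX y, OF \<nu> w_def, where B = N, folded C_def]
    coeff_Y1_eq[of \<nu> w FX y, OF \<nu> w_def, where B = N and K = K, folded C_def \<alpha>_def]
    coeff_Y2\<alpha>_eq[of \<nu> w FX y, OF \<nu> w_def, where B = N and K = K, folded C_def \<alpha>_def]
    coeff_Y2\<beta>_eq[of \<nu> w FX y, OF \<nu> w_def, where B = N and K = K, folded C_def \<beta>_def]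
  have C1: "C N k * real (N - 2 * k) = real N * C (N - 1) k" for k
    using binomial_absorb_diff[of N "2 * k"] by (simp add: C_def algebra_simps)
  have C2: "C N k * real ((N - 2 * k) choose 2) = real (N choose 2) * C (N - 2) k" for k
    using binomial_absorb_diff2[of N "2 * k"] by (simp add: C_def algebra_simps)
  let ?F = "FX y"
  have idx: "N - 2 * k - 1 = N - 1 - 2 * k" "N - 2 * k - 2 = N - 2 - 2 * k" for k
    by simp_all
  have d1: "C N k * (real (N - 2 * k) * ?F ^ (N - 2 * k - 1) * z)
      = real N * (C (N - 1) k * (?F ^ (N - 1 - 2 * k) * z))" for k z
    using arg_cong[OF C1[of k], of "\<lambda>x. x * (?F ^ (N - 1 - 2 * k) * z)"]
    unfolding idx by (simp add: ac_simps)
  have d2: "C N k * (real ((N - 2 * k) choose 2) * ?F ^ (N - 2 * k - 2) * z)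
      = real (N choose 2) * (C (N - 2) k * (?F ^ (N - 2 - 2 * k) * z))" for k z
    using arg_cong[OF C2[of k], of "\<lambda>x. x * (?F ^ (N - 2 - 2 * k) * z)"]
    unfolding idx by (simp add: ac_simps)
  note mean' = has_expansion_power[OF mean[folded g_def q_def]]
  note var' = has_expansion_power[OF var[folded \<alpha>_def \<beta>_def w_def]]
  note exp = has_expansion_sum[where I = "{..N}" and g = "\<lambda>k h. C N k * (\<mu> h ^ (N - 2 * k) * v h ^ k)",
      OF has_expansion_cmult[OF has_expansion_mult[OF mean' var']]]
  show ?thesis
  proof (rule has_expansion_eq[OF exp])
    show "(\<Sum>k\<le>N. C N k * (?F ^ (N - 2 * k) * w ^ k)) = coeff_E0 FX y \<nu> N"
      by (simp add: coeff_E0_def Y)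
  next
    fix h
    \<comment> \<open>The part from \<open>v\<close> already has the shape of
      \<open>coeff_Y1\<close>; the part from \<open>\<mu>\<close> is put into the shape in which
      \<open>d1\<close> lowers the index.\<close>
    have expand: "C N k * (?F ^ (N - 2 * k) * (real k * w ^ (k - 1) * (- \<alpha> * h1 h))
          + real (N - 2 * k) * ?F ^ (N - 2 * k - 1) * (- g * h1 h) * w ^ k)
        = - h1 h * (C N k * (?F ^ (N - 2 * k) * (real k * w ^ (k - 1) * \<alpha>)))
          - h1 h * g * (C N k * (real (N - 2 * k) * ?F ^ (N - 2 * k - 1) * w ^ k))" for k
      by (simp add: algebra_simps)
    show "(\<Sum>k\<le>N. C N k * (?F ^ (N - 2 * k) * (real k * w ^ (k - 1) * (- \<alpha> * h1 h))
          + real (N - 2 * k) * ?F ^ (N - 2 * k - 1) * (- g * h1 h) * w ^ k))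
        = h1 h * coeff_E1 FX K y \<nu> N"
      unfolding expand d1 by (simp add: coeff_E1_def Y g_def sum_subtractf sum.distrib sum_distrib_left sum_negf algebra_simps)
  next
    fix h
    \<comment> \<open>The five groups are linear in \<open>v\<close>, quadratic in \<open>v\<close>,
      mixed, linear in \<open>\<mu>\<close> and quadratic in \<open>\<mu>\<close>. The signs cancel
      in the mixed one and return through the minus sign of \<open>coeff_Y1\<close>.\<close>
    have expand: "C N k * (?F ^ (N - 2 * k) * (real k * w ^ (k - 1) * (\<beta> * h2 h)
              + real (k choose 2) * w ^ (k - 2) * (- \<alpha> * h1 h)\<^sup>2)
          + real (N - 2 * k) * ?F ^ (N - 2 * k - 1) * (- g * h1 h) * (real k * w ^ (k - 1) * (- \<alpha> * h1 h))
          + (real (N - 2 * k) * ?F ^ (N - 2 * k - 1) * (q * h2 h)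
              + real ((N - 2 * k) choose 2) * ?F ^ (N - 2 * k - 2) * (- g * h1 h)\<^sup>2) * w ^ k)
       = h2 h * (C N k * (?F ^ (N - 2 * k) * (real k * w ^ (k - 1) * \<beta>)))
         + (h1 h)\<^sup>2 * (C N k * (?F ^ (N - 2 * k) * (real (k choose 2) * w ^ (k - 2) * \<alpha>\<^sup>2)))
         + (h1 h)\<^sup>2 * g * (C N k * (real (N - 2 * k) * ?F ^ (N - 2 * k - 1) * (real k * w ^ (k - 1) * \<alpha>)))
         + h2 h * q * (C N k * (real (N - 2 * k) * ?F ^ (N - 2 * k - 1) * w ^ k))
         + (h1 h)\<^sup>2 * g\<^sup>2 * (C N k * (real ((N - 2 * k) choose 2) * ?F ^ (N - 2 * k - 2) * w ^ k))" for k
      by (simp add: algebra_simps power2_eq_square)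
    show "(\<Sum>k\<le>N. C N k * (?F ^ (N - 2 * k) * (real k * w ^ (k - 1) * (\<beta> * h2 h)
              + real (k choose 2) * w ^ (k - 2) * (- \<alpha> * h1 h)\<^sup>2)
          + real (N - 2 * k) * ?F ^ (N - 2 * k - 1) * (- g * h1 h) * (real k * w ^ (k - 1) * (- \<alpha> * h1 h))
          + (real (N - 2 * k) * ?F ^ (N - 2 * k - 1) * (q * h2 h)
              + real ((N - 2 * k) choose 2) * ?F ^ (N - 2 * k - 2) * (- g * h1 h)\<^sup>2) * w ^ k))
       = h2 h * coeff_E2a FX K y \<nu> N + (h1 h)\<^sup>2 * coeff_E2b FX K y \<nu> N"
      unfolding expand d1 d2
      by (simp add: coeff_E2a_def coeff_E2b_def Y g_def q_def sum.distrib sum_distrib_left sum_negf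
          power_mult_distrib algebra_simps)
  next
    show "\<forall>\<^sub>F h in F. (\<Sum>k\<le>N. C N k * (\<mu> h ^ (N - 2 * k) * v h ^ k))
        = (\<Sum>k\<le>N. real (N choose k) * \<mu> h ^ (N - k) * normal_central_moment (v h) k)"
      using nonneg by (rule eventually_mono) (simp add: normal_moment_sum C_def)
  qed
qed

end

section \<open>The mean of a smoothed indicator\<close>

lemma cdf_kernel_bounds:
  assumes "cdf_kernel K"
  shows "0 \<le> K u" "K u \<le> 1"
proof -
  have mono: "mono K" and lim0: "(K \<longlongrightarrow> 0) at_bot" and lim1: "(K \<longlongrightarrow> 1) at_top"
    using assms by (auto simp: cdf_kernel_def)
  show "0 \<le> K u"
  proof (rule tendsto_upperbound[OF lim0])
    show "\<forall>\<^sub>F x in at_bot. K x \<le> K u"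
      using eventually_le_at_bot[of u] by eventually_elim (rule monoD[OF mono])
  qed simp
  show "K u \<le> 1"
  proof (rule tendsto_lowerbound[OF lim1])
    show "\<forall>\<^sub>F x in at_top. K u \<le> K x"
      using eventually_ge_at_top[of u] by eventually_elim (rule monoD[OF mono])
  qed simp
qed

lemma cdf_kernel_borel: "cdf_kernel K \<Longrightarrow> K \<in> borel_measurable borel"
  by (auto simp: cdf_kernel_def intro: borel_measurable_mono)

text \<open>\<open>K\<close> itself need not be right-continuous, so the facts about
  \<open>interval_measure\<close> are applied to its right limit, which inherits monotonicity and
  both limits from \<open>K\<close>.\<close>

lemma
  fixes K :: "real \<Rightarrow> real"
  assumes K: "cdf_kernel K"
  shows real_distribution_kernel_dist: "real_distribution (kernel_dist K)"
    and cdf_kernel_dist: "cdf (kernel_dist K) u = Lim (at_right u) K"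
proof -
  have mono: "mono K" and lim0: "(K \<longlongrightarrow> 0) at_bot" and lim1: "(K \<longlongrightarrow> 1) at_top"
    using K by (auto simp: cdf_kernel_def)
  \<comment> \<open>For monotone \<open>K\<close> the right limit is an infimum. In this form it can
    be estimated before convergence is known, which \<open>Lim\<close> would not permit.\<close>
  define L where "L u = Inf (K ` {u<..})" for u
  have bdd: "bdd_below (K ` {u<..})" for u
    by (rule bdd_belowI[where m = 0]) (use cdf_kernel_bounds[OF K] in auto)
  have L_le: "L u \<le> K v" if "u < v" for u v
    unfolding L_def by (rule cInf_lower[OF _ bdd]) (use that in auto)
  have le_L: "K u \<le> L u" for u
    unfolding L_def by (rule cInf_greatest) (auto intro: monoD[OF mono])
  have L_less: "\<exists>v>u. K v < a" if "L u < a" for u a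
    using cInf_lessD[of "K ` {u<..}" a] that unfolding L_def by auto
  have L_mono: "L u \<le> L v" if "u \<le> v" for u v
    using L_le[of u] that L_less[of v] by (meson le_less_trans not_le_imp_less not_less)
  have lim: "(K \<longlongrightarrow> L u) (at_right u)" for u
  proof (rule order_tendstoI)
    fix a assume "a < L u"
    then show "\<forall>\<^sub>F x in at_right u. a < K x"
      by (intro eventually_at_right_less[THEN eventually_mono]) (erule less_le_trans[OF _ L_le])
  next
    fix a assume "L u < a"
    then obtain v where "v > u" "K v < a" using L_less by blast
    show "\<forall>\<^sub>F x in at_right u. K x < a"
      using eventually_at_right_real[OF \<open>v > u\<close>]
    proof eventually_elim
      case (elim x)
      then have "K x \<le> K v" by (intro monoD[OF mono]) simp
      with \<open>K v < a\<close> show ?case by simp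
    qed
  qed
  have Lim: "(\<lambda>u. Lim (at_right u) K) = L"
    using lim by (intro ext tendsto_Lim) simp_all
  have cont: "continuous (at_right a) L" for a
    unfolding continuous_within
  proof (rule order_tendstoI)
    fix b assume "b < L a"
    then show "\<forall>\<^sub>F x in at_right a. b < L x"
      by (intro eventually_at_right_less[THEN eventually_mono]) (erule less_le_trans[OF _ L_mono[OF less_imp_le]])
  next
    fix b assume "L a < b"
    then obtain v where "v > a" "K v < b" using L_less by blast
    show "\<forall>\<^sub>F x in at_right a. L x < b"
      using eventually_at_right_real[OF \<open>v > a\<close>]
    proof eventually_elim
      case (elim x)
      then have "L x \<le> K v" by (intro L_le) simp
      with \<open>K v < b\<close> show ?case by simp
    qed
  qed
  \<comment> \<open>Any positive shift would do: \<open>K u \<le> L u \<le> K (u + 1)\<close>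
    squeezes \<open>L\<close> at both ends.\<close>
  have L_upper: "L u \<le> K (u + 1)" for u
    by (rule L_le) simp
  have "filterlim (\<lambda>u::real. u + 1) at_bot at_bot"
    unfolding filterlim_at_bot
  proof
    fix Z :: real
    show "\<forall>\<^sub>F u in at_bot. u + 1 \<le> Z"
      using eventually_le_at_bot[of "Z - 1"] by eventually_elim simp
  qed
  then have shift_bot: "((\<lambda>u. K (u + 1)) \<longlongrightarrow> 0) at_bot"
    by (rule filterlim_compose[OF lim0])
  have "filterlim (\<lambda>u::real. u + 1) at_top at_top"
    unfolding filterlim_at_top
  proof
    fix Z :: real
    show "\<forall>\<^sub>F u in at_top. Z \<le> u + 1"
      using eventually_ge_at_top[of "Z - 1"] by eventually_elim simp
  qed
  then have shift_top: "((\<lambda>u. K (u + 1)) \<longlongrightarrow> 1) at_top"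
    by (rule filterlim_compose[OF lim1])
  have bot: "(L \<longlongrightarrow> 0) at_bot"
    by (rule tendsto_sandwich[OF _ _ lim0 shift_bot]) (auto intro!: always_eventually le_L L_upper)
  have top: "(L \<longlongrightarrow> 1) at_top"
    by (rule tendsto_sandwich[OF _ _ lim1 shift_top]) (auto intro!: always_eventually le_L L_upper)
  show "real_distribution (kernel_dist K)"
    unfolding kernel_dist_def Lim by (rule real_distribution_interval_measure[OF L_mono cont bot top])
  show "cdf (kernel_dist K) u = Lim (at_right u) K"
    using cdf_interval_measure[OF L_mono cont bot] Lim by (simp add: kernel_dist_def fun_eq_iff)
qed

lemma cdf_kernel_dist_isCont:
  assumes "cdf_kernel K" "isCont K u"
  shows "cdf (kernel_dist K) u = K u"
  using assms(2) unfolding cdf_kernel_dist[OF assms(1)] isCont_def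
  by (intro tendsto_Lim) (simp_all add: filterlim_at_split)

text \<open>A continuous distribution function leaves no atoms. Used for the sample points at which
  a kernel may differ from its right limit.\<close>

lemma (in real_distribution) null_sets_countable:
  assumes "\<And>x. isCont (cdf M) x" "countable A"
  shows "A \<in> null_sets M"
proof -
  have "{x} \<in> null_sets M" for x
    using assms(1)[of x] by (auto simp: isCont_cdf null_sets_def emeasure_eq_measure)
  then have "(\<Union>x\<in>A. {x}) \<in> null_sets M"
    by (intro null_sets_UN' assms(2))
  then show ?thesis by simp
qed

text \<open>If \<open>U\<close> has the distribution of the kernel and is independent of \<open>X\<close>, then both sides are the
  probability of \<open>X + t U \<le> y\<close>.\<close>

lemma integral_kernel_eq_integral_cdf:
  assumes K: "cdf_kernel K" and D: "real_distribution D" and cont: "\<And>x. isCont (cdf D) x" and t: "0 < t"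
  shows "(\<integral>x. K ((y - x) / t) \<partial>D) = (\<integral>u. cdf D (y - t * u) \<partial>kernel_dist K)"
proof -
  interpret D: real_distribution D by fact
  interpret U: real_distribution "kernel_dist K" by (rule real_distribution_kernel_dist[OF K])
  interpret P: pair_prob_space D "kernel_dist K" ..
  have [measurable]: "K \<in> borel_measurable borel" by (rule cdf_kernel_borel[OF K])
  have [measurable]: "cdf (kernel_dist K) \<in> borel_measurable borel"
    by (intro borel_measurable_mono monoI U.cdf_nondecreasing)
  \<comment> \<open>The points \<open>x\<close> for which \<open>(y - x) / t\<close> hits a
    discontinuity of \<open>K\<close>. A monotone function has countably many of these, so
    \<open>N\<close> is null for \<open>D\<close>.\<close>
  define N where "N = (\<lambda>u. y - t * u) ` {u. \<not> isCont K u}"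
  have "countable N"
    using K unfolding N_def by (intro countable_image mono_ctble_discont) (auto simp: cdf_kernel_def)
  then have "N \<in> null_sets D"
    using cont D.null_sets_countable by blast
  moreover have "{x. K ((y - x) / t) \<noteq> cdf (kernel_dist K) ((y - x) / t)} \<subseteq> N"
  proof
    fix x assume "x \<in> {x. K ((y - x) / t) \<noteq> cdf (kernel_dist K) ((y - x) / t)}"
    then have "\<not> isCont K ((y - x) / t)"
      using cdf_kernel_dist_isCont[OF K, of "(y - x) / t"] by auto
    moreover have "x = y - t * ((y - x) / t)" using t by simp
    ultimately show "x \<in> N" unfolding N_def by blast
  qed
  ultimately have "AE x in D. K ((y - x) / t) = cdf (kernel_dist K) ((y - x) / t)"
    by (intro AE_I'[of N]) auto
  then have "(\<integral>x. K ((y - x) / t) \<partial>D) = (\<integral>x. cdf (kernel_dist K) ((y - x) / t) \<partial>D)"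
    by (intro integral_cong_AE) auto
  also have "\<dots> = (\<integral>x. (\<integral>u. indicat_real {(x, u). x + t * u \<le> y} (x, u) \<partial>kernel_dist K) \<partial>D)"
  proof (rule Bochner_Integration.integral_cong[OF refl])
    fix x
    have "(\<integral>u. indicat_real {(x, u). x + t * u \<le> y} (x, u) \<partial>kernel_dist K)
        = (\<integral>u. indicat_real {..(y - x) / t} u \<partial>kernel_dist K)"
      using t by (intro Bochner_Integration.integral_cong) (auto simp: indicator_def field_simps)
    then show "cdf (kernel_dist K) ((y - x) / t)
        = (\<integral>u. indicat_real {(x, u). x + t * u \<le> y} (x, u) \<partial>kernel_dist K)"
      by (simp add: cdf_def)
  qed
  also have "\<dots> = (\<integral>u. (\<integral>x. indicat_real {(x, u). x + t * u \<le> y} (x, u) \<partial>D) \<partial>kernel_dist K)"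
  proof (rule P.Fubini_integral[symmetric])
    have "{p \<in> space (borel \<Otimes>\<^sub>M borel). fst p + t * snd p \<le> y} \<in> sets (borel \<Otimes>\<^sub>M borel)"
      by measurable
    then have [measurable]: "{(x, u). x + t * u \<le> y} \<in> sets (borel \<Otimes>\<^sub>M borel)"
      by (simp add: space_pair_measure case_prod_beta')
    show "integrable (D \<Otimes>\<^sub>M kernel_dist K) (\<lambda>(x, u). indicat_real {(x, u). x + t * u \<le> y} (x, u))"
      by (rule P.P.integrable_const_bound[where B = 1]) auto
  qed
  also have "\<dots> = (\<integral>u. cdf D (y - t * u) \<partial>kernel_dist K)"
  proof (rule Bochner_Integration.integral_cong[OF refl])
    fix u
    have "(\<integral>x. indicat_real {(x, u). x + t * u \<le> y} (x, u) \<partial>D) = (\<integral>x. indicat_real {..y - t * u} x \<partial>D)"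
      by (intro Bochner_Integration.integral_cong) (auto simp: indicator_def)
    then show "(\<integral>x. indicat_real {(x, u). x + t * u \<le> y} (x, u) \<partial>D) = cdf D (y - t * u)"
      by (simp add: cdf_def)
  qed
  finally show ?thesis .
qed

section \<open>Taylor expansion of the mean\<close>

lemma C_diff_mono:
  assumes "C_diff r F" "q \<le> r"
  shows "C_diff q F"
proof (cases "q = r")
  case False
  then have "continuous_on UNIV ((deriv ^^ q) F)"
    using assms by (intro continuous_at_imp_continuous_on ballI differentiable_imp_continuous_within)
      (auto simp: C_diff_def)
  then show ?thesis using assms by (auto simp: C_diff_def)
qed (use assms in simp)

lemma C_diff_isCont:
  assumes "C_diff r F" "q \<le> r"
  shows "isCont ((deriv ^^ q) F) x"
  using C_diff_mono[OF assms] by (auto simp: C_diff_def continuous_on_eq_continuous_at)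

lemma C_diff_Taylor:
  assumes "C_diff r F"
  shows "\<exists>\<xi>. \<bar>\<xi>\<bar> \<le> \<bar>t\<bar> \<and>
    F (y + t) = (\<Sum>q<r. (deriv ^^ q) F y / fact q * t ^ q) + (deriv ^^ r) F (y + \<xi>) / fact r * t ^ r"
proof -
  have "DERIV (\<lambda>t. (deriv ^^ q) F (y + t)) x :> (deriv ^^ Suc q) F (y + x)" if "q < r" for q x
  proof -
    have "DERIV ((deriv ^^ q) F) (y + x) :> (deriv ^^ Suc q) F (y + x)"
      using assms that by (auto simp: C_diff_def DERIV_deriv_iff_real_differentiable)
    then show ?thesis
      by (simp add: DERIV_shift add.commute)
  qed
  then show ?thesis
    using Maclaurin_bi_le[of "\<lambda>q t. (deriv ^^ q) F (y + t)" "\<lambda>t. F (y + t)" r t] by simp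
qed

text \<open>The rest after the quadratic term in both smoothness classes: a third derivative
  improves its bound, not its definition.\<close>

definition taylor2_rest :: "(real \<Rightarrow> real) \<Rightarrow> real \<Rightarrow> real \<Rightarrow> real" where
  "taylor2_rest F y t = F (y + t) - (F y + deriv F y * t + deriv (deriv F) y / 2 * t\<^sup>2)"

text \<open>By the Lagrange form the rest is \<open>t^2 / 2\<close> times the change of the second
  derivative over a distance of at most \<open>|t|\<close>; its continuity at \<open>y\<close> makes
  this small.\<close>

lemma taylor2_rest_tendsto:
  assumes "C_diff 2 F"
  shows "((\<lambda>t. taylor2_rest F y t / t\<^sup>2) \<longlongrightarrow> 0) (at 0)"
proof -
  have "isCont (deriv (deriv F)) y"
    using C_diff_isCont[OF assms, of 2 y] by (simp add: numeral_2_eq_2)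
  show ?thesis
  proof (rule tendstoI)
    fix e :: real assume "0 < e"
    then obtain d where d: "d > 0" "\<And>x. dist x y < d \<Longrightarrow> dist (deriv (deriv F) x) (deriv (deriv F) y) < e"
      using \<open>isCont (deriv (deriv F)) y\<close> unfolding continuous_at_eps_delta by blast
    have "dist (taylor2_rest F y t / t\<^sup>2) 0 < e" if t: "t \<noteq> 0" "\<bar>t\<bar> < d" for t
    proof -
      obtain \<xi> where \<xi>: "\<bar>\<xi>\<bar> \<le> \<bar>t\<bar>" "F (y + t) = (\<Sum>q<2. (deriv ^^ q) F y / fact q * t ^ q)
          + (deriv ^^ 2) F (y + \<xi>) / fact 2 * t ^ 2"
        using C_diff_Taylor[OF assms] by blast
      have "taylor2_rest F y t = (deriv (deriv F) (y + \<xi>) - deriv (deriv F) y) / 2 * t\<^sup>2"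
        using \<xi>(2) by (simp add: taylor2_rest_def numeral_2_eq_2 field_simps)
      then have "taylor2_rest F y t / t\<^sup>2 = (deriv (deriv F) (y + \<xi>) - deriv (deriv F) y) / 2"
        using t(1) by simp
      then have "\<bar>taylor2_rest F y t / t\<^sup>2\<bar> = \<bar>deriv (deriv F) (y + \<xi>) - deriv (deriv F) y\<bar> / 2"
        by (simp only: abs_divide abs_numeral)
      also have "\<dots> < e"
        using d(2)[of "y + \<xi>"] \<xi>(1) t \<open>0 < e\<close> by (simp add: dist_real_def)
      finally show ?thesis by simp
    qed
    then show "\<forall>\<^sub>F t in at 0. dist (taylor2_rest F y t / t\<^sup>2) 0 < e"
      using d(1) by (auto simp: eventually_at dist_real_def)
  qed
qed

text \<open>The kernel may have unbounded support, so the bound has to hold for all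
  \<open>t\<close>. For \<open>|t| \<le> 1\<close> it comes from the Lagrange form and compactness;
  beyond, \<open>F\<close> is bounded and \<open>|t| ^ p\<close> dominates every term of the
  quadratic polynomial.\<close>

lemma taylor2_rest_bound:
  assumes bounded: "\<And>x. \<bar>F x\<bar> \<le> 1" and p: "p = 2 \<or> p = 3" and diff: "C_diff p F"
  obtains C where "\<And>t. \<bar>taylor2_rest F y t\<bar> \<le> C * \<bar>t\<bar> ^ p"
proof -
  \<comment> \<open>The 2 covers the two values of \<open>F\<close>, the other terms the linear and
    the quadratic coefficient; the factor 1/2 of the latter is given away.\<close>
  define A where "A = 2 + \<bar>deriv F y\<bar> + \<bar>deriv (deriv F) y\<bar>"
  have "continuous_on {y - 1..y + 1} ((deriv ^^ p) F)"
    using diff by (auto simp: C_diff_def intro: continuous_on_subset)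
  then have "bounded ((deriv ^^ p) F ` {y - 1..y + 1})"
    by (intro compact_imp_bounded compact_continuous_image) auto
  then obtain B where B: "\<And>x. x \<in> {y - 1..y + 1} \<Longrightarrow> \<bar>(deriv ^^ p) F x\<bar> \<le> B"
    unfolding bounded_iff by (metis image_eqI real_norm_def)
  have near: "\<bar>taylor2_rest F y t\<bar> \<le> B * \<bar>t\<bar> ^ p" if t: "\<bar>t\<bar> \<le> 1" for t
  proof -
    obtain \<xi> where \<xi>: "\<bar>\<xi>\<bar> \<le> \<bar>t\<bar>" "F (y + t) = (\<Sum>q<p. (deriv ^^ q) F y / fact q * t ^ q)
        + (deriv ^^ p) F (y + \<xi>) / fact p * t ^ p"
      using C_diff_Taylor[OF diff] by blast
    have b: "\<bar>(deriv ^^ p) F (y + \<xi>)\<bar> \<le> B" "\<bar>(deriv ^^ p) F y\<bar> \<le> B"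
      using \<xi>(1) t by (auto intro!: B)
    from p show ?thesis
    proof
      assume [simp]: "p = 2"
      have "taylor2_rest F y t = (deriv (deriv F) (y + \<xi>) - deriv (deriv F) y) / 2 * t\<^sup>2"
        using \<xi>(2) by (simp add: taylor2_rest_def numeral_2_eq_2 field_simps)
      then have "\<bar>taylor2_rest F y t\<bar> = \<bar>(deriv (deriv F) (y + \<xi>) - deriv (deriv F) y) / 2\<bar> * t\<^sup>2"
        by (simp only: abs_mult abs_power2)
      also have "\<dots> \<le> B * t\<^sup>2"
        using b by (intro mult_right_mono) (auto simp: numeral_2_eq_2)
      finally show ?thesis by simp
    next
      assume [simp]: "p = 3"
      have "taylor2_rest F y t = (deriv ^^ 3) F (y + \<xi>) / 6 * t ^ 3"
        using \<xi>(2) by (simp add: taylor2_rest_def numeral_3_eq_3 power2_eq_square fact_numeral field_simps)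
      then have "\<bar>taylor2_rest F y t\<bar> = \<bar>(deriv ^^ 3) F (y + \<xi>) / 6\<bar> * \<bar>t\<bar> ^ 3"
        by (simp only: abs_mult power_abs)
      also have "\<dots> \<le> B * \<bar>t\<bar> ^ 3"
        using b by (intro mult_right_mono) auto
      finally show ?thesis by simp
    qed
  qed
  have far: "\<bar>taylor2_rest F y t\<bar> \<le> A * \<bar>t\<bar> ^ p" if t: "1 < \<bar>t\<bar>" for t
  proof -
    have pow: "1 \<le> \<bar>t\<bar> ^ p" "\<bar>t\<bar> \<le> \<bar>t\<bar> ^ p" "\<bar>t\<bar>\<^sup>2 \<le> \<bar>t\<bar> ^ p"
      using t p power_increasing[of 1 p "\<bar>t\<bar>"] power_increasing[of 2 p "\<bar>t\<bar>"] by auto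
    have "\<bar>taylor2_rest F y t\<bar> \<le> \<bar>F (y + t)\<bar> + \<bar>F y\<bar> + \<bar>deriv F y * t\<bar> + \<bar>deriv (deriv F) y / 2 * t\<^sup>2\<bar>"
      unfolding taylor2_rest_def by linarith
    also have "\<dots> \<le> 2 * 1 + \<bar>deriv F y\<bar> * \<bar>t\<bar> + \<bar>deriv (deriv F) y\<bar> * \<bar>t\<bar>\<^sup>2"
    proof -
      have "\<bar>deriv (deriv F) y / 2 * t\<^sup>2\<bar> = \<bar>deriv (deriv F) y\<bar> * \<bar>t\<bar>\<^sup>2 / 2"
        by (simp add: abs_mult)
      also have "\<dots> \<le> \<bar>deriv (deriv F) y\<bar> * \<bar>t\<bar>\<^sup>2"
        by simp
      finally show ?thesis
        using bounded[of y] bounded[of "y + t"] unfolding abs_mult[of _ t] by linarith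
    qed
    also have "\<dots> \<le> 2 * \<bar>t\<bar> ^ p + \<bar>deriv F y\<bar> * \<bar>t\<bar> ^ p + \<bar>deriv (deriv F) y\<bar> * \<bar>t\<bar> ^ p"
      using pow by (intro add_mono mult_left_mono) auto
    finally show ?thesis by (simp add: A_def algebra_simps)
  qed
  have "\<bar>taylor2_rest F y t\<bar> \<le> max A B * \<bar>t\<bar> ^ p" for t
  proof (cases "\<bar>t\<bar> \<le> 1")
    case True
    then show ?thesis
      using order_trans[OF near] by (simp add: mult_right_mono)
  next
    case False
    then show ?thesis
      using order_trans[OF far] by (simp add: mult_right_mono)
  qed
  then show thesis by (rule that)
qed

definition kernel_mean_rest :: "(real \<Rightarrow> real) \<Rightarrow> (real \<Rightarrow> real) \<Rightarrow> real \<Rightarrow> real \<Rightarrow> real" where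
  "kernel_mean_rest F K y t = (\<integral>u. F (y - t * u) \<partial>kernel_dist K)
     - (F y - deriv F y * kernel_moment K 1 * t + deriv (deriv F) y / 2 * kernel_moment K 2 * t\<^sup>2)"

context
  fixes F K :: "real \<Rightarrow> real" and y :: real
  assumes K: "cdf_kernel K" and bounded: "\<And>x. \<bar>F x\<bar> \<le> 1" and diff: "C_diff 2 F"
    and moments: "has_kernel_moment K 1" "has_kernel_moment K 2"
begin

lemma borel_measurable_C2: "F \<in> borel_measurable borel"
  using C_diff_isCont[OF diff, of 0]
  by (intro borel_measurable_continuous_onI continuous_at_imp_continuous_on) auto

lemma kernel_mean_rest_eq:
  "kernel_mean_rest F K y t = (\<integral>u. taylor2_rest F y (- t * u) \<partial>kernel_dist K)"
proof -
  interpret U: real_distribution "kernel_dist K" by (rule real_distribution_kernel_dist[OF K])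
  note [measurable] = borel_measurable_C2
  have i1: "integrable (kernel_dist K) (\<lambda>u. u)" and i2: "integrable (kernel_dist K) (\<lambda>u. u\<^sup>2)"
    using moments by (simp_all add: has_kernel_moment_def)
  have i0: "integrable (kernel_dist K) (\<lambda>u. F (y - t * u))"
    by (rule U.integrable_const_bound[where B = 1]) (use bounded in auto)
  have "(\<integral>u. taylor2_rest F y (- t * u) \<partial>kernel_dist K)
     = (\<integral>u. F (y - t * u) - (F y + (- deriv F y * t) * u + (deriv (deriv F) y / 2 * t\<^sup>2) * u\<^sup>2) \<partial>kernel_dist K)"
    by (simp add: taylor2_rest_def power_mult_distrib algebra_simps)
  also have "\<dots> = (\<integral>u. F (y - t * u) \<partial>kernel_dist K)
      - (F y + (- deriv F y * t) * (\<integral>u. u \<partial>kernel_dist K)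
          + (deriv (deriv F) y / 2 * t\<^sup>2) * (\<integral>u. u\<^sup>2 \<partial>kernel_dist K))"
    using i0 i1 i2 U.prob_space by simp
  finally show ?thesis
    by (simp add: kernel_mean_rest_def kernel_moment_def algebra_simps)
qed

text \<open>Dominated convergence, taken along sequences: the scaled rest tends to 0 for each
  \<open>u\<close>, and the global bound gives the majorant \<open>C * u^2\<close>, which does not
  depend on \<open>t\<close>.\<close>

lemma kernel_mean_rest_smallo: "kernel_mean_rest F K y \<in> o[at_right 0](\<lambda>t. t\<^sup>2)"
proof -
  interpret U: real_distribution "kernel_dist K" by (rule real_distribution_kernel_dist[OF K])
  note [measurable] = borel_measurable_C2
  obtain C where C: "\<And>t. \<bar>taylor2_rest F y t\<bar> \<le> C * \<bar>t\<bar> ^ 2"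
    using taylor2_rest_bound[of F 2 y, OF bounded _ diff] by auto
  have "((\<lambda>t. kernel_mean_rest F K y t / t\<^sup>2) \<longlongrightarrow> 0) (at_right 0)"
    unfolding tendsto_at_iff_sequentially
  proof (intro allI impI)
    fix T :: "nat \<Rightarrow> real" assume T: "\<forall>i. T i \<in> {0<..} - {0}" "T \<longlonglongrightarrow> 0"
    have "(\<lambda>i. \<integral>u. taylor2_rest F y (- T i * u) / (T i)\<^sup>2 \<partial>kernel_dist K)
        \<longlonglongrightarrow> (\<integral>u. 0 \<partial>kernel_dist K)"
    proof (rule integral_dominated_convergence[where w = "\<lambda>u. C * u\<^sup>2"])
      show "integrable (kernel_dist K) (\<lambda>u. C * u\<^sup>2)"
        using moments by (simp add: has_kernel_moment_def)
      show "AE u in kernel_dist K. (\<lambda>i. taylor2_rest F y (- T i * u) / (T i)\<^sup>2) \<longlonglongrightarrow> 0"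
      proof (rule AE_I2)
        fix u
        show "(\<lambda>i. taylor2_rest F y (- T i * u) / (T i)\<^sup>2) \<longlonglongrightarrow> 0"
        \<comment> \<open>The quotient is read as \<open>taylor2_rest F y s / s^2 * u^2\<close> with
          \<open>s = - T i * u\<close>, which tends to 0 without reaching it only if
          \<open>u \<noteq> 0\<close>.\<close>
        proof (cases "u = 0")
          case True
          then show ?thesis by (simp add: taylor2_rest_def)
        next
          case False
          have "filterlim (\<lambda>i. - T i * u) (at 0) sequentially"
            using T False tendsto_mult[OF tendsto_minus[OF T(2)] tendsto_const[of u]]
            by (auto simp: filterlim_at less_imp_neq[symmetric])
          then have "(\<lambda>i. taylor2_rest F y (- T i * u) / (- T i * u)\<^sup>2 * u\<^sup>2) \<longlonglongrightarrow> 0 * u\<^sup>2"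
            by (intro tendsto_mult tendsto_const filterlim_compose[OF taylor2_rest_tendsto[OF diff]])
          then show ?thesis
            using False by (simp add: power_mult_distrib)
        qed
      qed
      fix i
      show "AE u in kernel_dist K. norm (taylor2_rest F y (- T i * u) / (T i)\<^sup>2) \<le> C * u\<^sup>2"
      proof (rule AE_I2)
        fix u
        have "T i > 0" using T by auto
        then show "norm (taylor2_rest F y (- T i * u) / (T i)\<^sup>2) \<le> C * u\<^sup>2"
          using C[of "- T i * u"] by (simp add: power_mult_distrib field_simps)
      qed
    qed (simp_all add: taylor2_rest_def)
    then show "((\<lambda>t. kernel_mean_rest F K y t / t\<^sup>2) \<circ> T) \<longlonglongrightarrow> 0"
      by (simp add: o_def kernel_mean_rest_eq)
  qed
  then show ?thesis
    by (rule smalloI_tendsto) (auto simp: eventually_at_filter)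
qed

lemma kernel_mean_rest_bigo:
  assumes "C_diff 3 F" "has_kernel_moment K 3"
  shows "kernel_mean_rest F K y \<in> O[at_right 0](\<lambda>t. t ^ 3)"
proof -
  interpret U: real_distribution "kernel_dist K" by (rule real_distribution_kernel_dist[OF K])
  note [measurable] = borel_measurable_C2
  obtain C where C: "\<And>t. \<bar>taylor2_rest F y t\<bar> \<le> C * \<bar>t\<bar> ^ 3"
    using taylor2_rest_bound[of F 3 y, OF bounded _ assms(1)] by auto
  have int: "integrable (kernel_dist K) (\<lambda>u. \<bar>u\<bar> ^ 3)"
    using assms(2) integrable_abs by (fastforce simp: has_kernel_moment_def power_abs)
  define B where "B = C * (\<integral>u. \<bar>u\<bar> ^ 3 \<partial>kernel_dist K)"
  have "\<bar>kernel_mean_rest F K y t\<bar> \<le> B * \<bar>t ^ 3\<bar>" for t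
  proof -
    have bound: "\<bar>taylor2_rest F y (- t * u)\<bar> \<le> C * \<bar>t\<bar> ^ 3 * \<bar>u\<bar> ^ 3" for u
      using C[of "- t * u"] by (simp add: abs_mult power_mult_distrib mult.assoc)
    have "\<bar>kernel_mean_rest F K y t\<bar> \<le> (\<integral>u. \<bar>taylor2_rest F y (- t * u)\<bar> \<partial>kernel_dist K)"
      unfolding kernel_mean_rest_eq by (rule integral_abs_bound)
    also have "\<dots> \<le> (\<integral>u. C * \<bar>t\<bar> ^ 3 * \<bar>u\<bar> ^ 3 \<partial>kernel_dist K)"
    proof (rule integral_mono)
      show int': "integrable (kernel_dist K) (\<lambda>u. C * \<bar>t\<bar> ^ 3 * \<bar>u\<bar> ^ 3)"
        using int by simp
      show "integrable (kernel_dist K) (\<lambda>u. \<bar>taylor2_rest F y (- t * u)\<bar>)"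
      proof (rule Bochner_Integration.integrable_bound[OF int'])
        show "(\<lambda>u. \<bar>taylor2_rest F y (- t * u)\<bar>) \<in> borel_measurable (kernel_dist K)"
          unfolding taylor2_rest_def by measurable
        show "AE u in kernel_dist K. norm \<bar>taylor2_rest F y (- t * u)\<bar> \<le> norm (C * \<bar>t\<bar> ^ 3 * \<bar>u\<bar> ^ 3)"
        proof (rule AE_I2)
          fix u
          show "norm \<bar>taylor2_rest F y (- t * u)\<bar> \<le> norm (C * \<bar>t\<bar> ^ 3 * \<bar>u\<bar> ^ 3)"
            unfolding real_norm_def abs_abs using bound abs_ge_self by (rule order_trans)
        qed
      qed
    qed (rule bound)
    finally show ?thesis by (simp add: B_def power_abs mult.commute mult.left_commute)
  qed
  then show ?thesis
    by (intro bigoI[where c = B]) auto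
qed

end

section \<open>Bias and variance of the estimator\<close>

context prob_space
begin

text \<open>Bienayme's identity. Square integrability is part of the induction because
  \<open>variance_eq\<close> requires it of each partial sum.\<close>

lemma square_integrable_sum_indep:
  fixes Y :: "'i \<Rightarrow> 'a \<Rightarrow> real"
  assumes "finite I" "indep_vars (\<lambda>_. borel) Y I"
    "\<And>i. i \<in> I \<Longrightarrow> integrable M (Y i)" "\<And>i. i \<in> I \<Longrightarrow> integrable M (\<lambda>\<omega>. (Y i \<omega>)\<^sup>2)"
  shows "integrable M (\<lambda>\<omega>. (\<Sum>i\<in>I. Y i \<omega>)\<^sup>2)"
    and "variance (\<lambda>\<omega>. \<Sum>i\<in>I. Y i \<omega>) = (\<Sum>i\<in>I. variance (Y i))"
proof -
  have "integrable M (\<lambda>\<omega>. (\<Sum>i\<in>I. Y i \<omega>)\<^sup>2) \<and>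
      variance (\<lambda>\<omega>. \<Sum>i\<in>I. Y i \<omega>) = (\<Sum>i\<in>I. variance (Y i))"
    using assms
  proof (induction I rule: finite_induct)
    case (insert i I)
    let ?S = "\<lambda>\<omega>. \<Sum>i\<in>I. Y i \<omega>"
    have "indep_vars (\<lambda>_. borel) Y I"
      using insert.prems(1) by (rule indep_vars_subset) auto
    then have IH: "integrable M (\<lambda>\<omega>. (?S \<omega>)\<^sup>2)" "variance ?S = (\<Sum>i\<in>I. variance (Y i))"
      using insert by auto
    have Yi: "integrable M (Y i)" "integrable M (\<lambda>\<omega>. (Y i \<omega>)\<^sup>2)" and S: "integrable M ?S"
      using insert.prems by auto
    have indep: "indep_var borel (Y i) borel ?S"
      using insert.hyps insert.prems(1) by (rule indep_vars_sum)
    have prod: "integrable M (\<lambda>\<omega>. Y i \<omega> * ?S \<omega>)"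
        "expectation (\<lambda>\<omega>. Y i \<omega> * ?S \<omega>) = expectation (Y i) * expectation ?S"
      using indep_var_integrable[OF indep Yi(1) S] indep_var_lebesgue_integral[OF indep Yi(1) S] by auto
    have sq: "(\<lambda>\<omega>. (Y i \<omega> + ?S \<omega>)\<^sup>2) = (\<lambda>\<omega>. (Y i \<omega>)\<^sup>2 + (?S \<omega>)\<^sup>2 + 2 * (Y i \<omega> * ?S \<omega>))"
      by (simp add: power2_sum mult.assoc)
    have int: "integrable M (\<lambda>\<omega>. (Y i \<omega> + ?S \<omega>)\<^sup>2)"
      unfolding sq using Yi IH prod by auto
    have "variance (\<lambda>\<omega>. Y i \<omega> + ?S \<omega>) = variance (Y i) + variance ?S"
      unfolding variance_eq[OF Yi] variance_eq[OF S IH(1)]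
        variance_eq[OF Bochner_Integration.integrable_add[OF Yi(1) S] int] sq
      using Yi S IH(1) prod by (simp add: power2_sum algebra_simps)
    then show ?case
      using insert.hyps int IH(2) by simp
  qed simp
  then show "integrable M (\<lambda>\<omega>. (\<Sum>i\<in>I. Y i \<omega>)\<^sup>2)"
    "variance (\<lambda>\<omega>. \<Sum>i\<in>I. Y i \<omega>) = (\<Sum>i\<in>I. variance (Y i))" by auto
qed

text \<open>The bias-variance decomposition.\<close>

lemma mean_square_deviation:
  fixes Z :: "'a \<Rightarrow> real"
  assumes "integrable M Z" "integrable M (\<lambda>\<omega>. (Z \<omega>)\<^sup>2)"
  shows "expectation (\<lambda>\<omega>. (Z \<omega> - c)\<^sup>2) = (expectation Z - c)\<^sup>2 + variance Z"
  unfolding variance_eq[OF assms] using assms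
  by (simp add: power2_diff prob_space algebra_simps)

lemma moment_binomial:
  fixes W :: "'a \<Rightarrow> real"
  assumes [measurable]: "random_variable borel W" and bounded: "\<And>\<omega>. \<bar>W \<omega>\<bar> \<le> B"
  shows "expectation (\<lambda>\<omega>. W \<omega> ^ N) =
    (\<Sum>k\<le>N. real (N choose k) * expectation W ^ (N - k) * expectation (\<lambda>\<omega>. (W \<omega> - expectation W) ^ k))"
proof -
  let ?e = "expectation W"
  have int: "integrable M (\<lambda>\<omega>. (W \<omega> - ?e) ^ k)" for k
  proof (rule integrable_const_bound[where B = "(B + \<bar>?e\<bar>) ^ k"])
    show "AE \<omega> in M. norm ((W \<omega> - ?e) ^ k) \<le> (B + \<bar>?e\<bar>) ^ k"
    proof (rule AE_I2)
      fix \<omega>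
      have "\<bar>W \<omega> - ?e\<bar> \<le> B + \<bar>?e\<bar>" using bounded[of \<omega>] by linarith
      then show "norm ((W \<omega> - ?e) ^ k) \<le> (B + \<bar>?e\<bar>) ^ k"
        unfolding real_norm_def power_abs by (rule power_mono) simp
    qed
  qed simp
  have "W \<omega> ^ N = (\<Sum>k\<le>N. real (N choose k) * ?e ^ (N - k) * (W \<omega> - ?e) ^ k)" for \<omega>
    using binomial_ring[of "W \<omega> - ?e" ?e N] by (simp add: ac_simps)
  then show ?thesis
    using int by (simp add: integral_sum)
qed

end

section \<open>The sample and the exact identities for the estimator\<close>

locale ddevd_sample = prob_space M for M :: "'a measure" +
  fixes X :: "nat \<Rightarrow> nat \<Rightarrow> 'a \<Rightarrow> real" and FX K :: "real \<Rightarrow> real" and m :: nat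
    and n :: "nat \<Rightarrow> nat" and y :: real
  assumes m: "m > 0" and n: "\<forall>i\<in>{1..m}. n i > 0"
    and indep: "indep_vars (\<lambda>_. borel) (\<lambda>(i, j). X i j) (block_indices m n)"
    and ident: "\<forall>(i, j)\<in>block_indices m n. cdf (distr M borel (X i j)) = FX"
    and FX: "C_diff 2 FX"
    and K: "cdf_kernel K"
    and moments: "\<forall>p\<in>{1, 2}. has_kernel_moment K p \<and> has_kernel_moment (ksq K) p"
begin

lemma random_variable_X [measurable]:
  "i \<in> {1..m} \<Longrightarrow> j \<in> {1..n i} \<Longrightarrow> random_variable borel (X i j)"
  using indep by (auto simp: indep_vars_def block_indices_def)

lemma kernel_borel [measurable]: "K \<in> borel_measurable borel"
  by (rule cdf_kernel_borel[OF K])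

lemma kernel_bounds: "0 \<le> K u" "K u \<le> 1"
  by (rule cdf_kernel_bounds[OF K])+

lemma inner_approx_bounds: "0 \<le> inner_approx X K n h i y \<omega>" "inner_approx X K n h i y \<omega> \<le> 1"
proof -
  show "0 \<le> inner_approx X K n h i y \<omega>"
    unfolding inner_approx_def by (intro mult_nonneg_nonneg sum_nonneg kernel_bounds) auto
  have "(\<Sum>j=1..n i. K ((y - X i j \<omega>) / h i j)) \<le> (\<Sum>j=1..n i. 1)"
    by (intro sum_mono kernel_bounds)
  then show "inner_approx X K n h i y \<omega> \<le> 1"
    unfolding inner_approx_def by (cases "n i = 0") (auto simp: field_simps)
qed

lemma random_variable_inner_approx [measurable]:
  "i \<in> {1..m} \<Longrightarrow> random_variable borel (inner_approx X K n h i y)"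
  unfolding inner_approx_def by measurable

lemma integrable_inner_approx_power:
  "i \<in> {1..m} \<Longrightarrow> integrable M (\<lambda>\<omega>. inner_approx X K n h i y \<omega> ^ N)"
  by (rule integrable_const_bound[where B = 1])
    (use inner_approx_bounds in \<open>auto simp: power_le_one\<close>)

text \<open>The rows of the index set are disjoint, so the row vectors, taken as variables with
  values in product spaces, are independent; each power is a measurable function of its own
  row.\<close>

lemma indep_vars_inner_approx_power:
  "indep_vars (\<lambda>_. borel) (\<lambda>i \<omega>. inner_approx X K n h i y \<omega> ^ n i) {1..m}"
proof -
  let ?J = "\<lambda>i. {i} \<times> {1..n i}"
  have "indep_vars (\<lambda>i. PiM (?J i) (\<lambda>_. borel)) (\<lambda>i \<omega>. restrict (\<lambda>p. (case p of (i, j) \<Rightarrow> X i j) \<omega>) (?J i)) {1..m}"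
    using indep by (rule indep_vars_restrict) (auto simp: block_indices_def disjoint_family_on_def)
  then have "indep_vars (\<lambda>_. borel) (\<lambda>i \<omega>. ((1 / real (n i)) * (\<Sum>j=1..n i.
      K ((y - restrict (\<lambda>p. (case p of (i, j) \<Rightarrow> X i j) \<omega>) (?J i) (i, j)) / h i j))) ^ n i) {1..m}"
    by (rule indep_vars_compose2) measurable
  then show ?thesis
    by (simp add: inner_approx_def)
qed

lemma integrable_ddevd: "integrable M (ddevd X K m n h y)"
  unfolding ddevd_def by (intro integrable_mult_right Bochner_Integration.integrable_sum integrable_inner_approx_power)

lemma expectation_ddevd:
  "expectation (ddevd X K m n h y) - target_cdf FX m n y
     = (1 / real m) * (\<Sum>i=1..m. block_bias M X FX K n h i y)"
  unfolding ddevd_def target_cdf_def block_bias_def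
  by (simp add: integrable_inner_approx_power sum_subtractf diff_divide_distrib)

lemma
  shows integrable_ddevd_square: "integrable M (\<lambda>\<omega>. (ddevd X K m n h y \<omega>)\<^sup>2)"
    and variance_ddevd: "variance (ddevd X K m n h y)
         = (1 / (real m)\<^sup>2) * (\<Sum>i=1..m. block_variance M X K n h i y)"
proof -
  let ?S = "\<lambda>\<omega>. \<Sum>i=1..m. inner_approx X K n h i y \<omega> ^ n i"
  note S = square_integrable_sum_indep[OF _ indep_vars_inner_approx_power]
  have int: "integrable M (\<lambda>\<omega>. (?S \<omega>)\<^sup>2)"
    by (rule S) (auto simp flip: power_mult intro!: integrable_inner_approx_power)
  have var: "variance ?S = (\<Sum>i=1..m. block_variance M X K n h i y)"
    unfolding block_variance_def
    by (rule S) (auto simp flip: power_mult intro!: integrable_inner_approx_power)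
  show "integrable M (\<lambda>\<omega>. (ddevd X K m n h y \<omega>)\<^sup>2)"
    unfolding ddevd_def power_mult_distrib using int by simp
  have "variance (ddevd X K m n h y) = expectation (\<lambda>\<omega>. (1 / (real m)\<^sup>2) * (?S \<omega> - expectation ?S)\<^sup>2)"
    unfolding ddevd_def by (simp add: power_divide flip: diff_divide_distrib)
  then show "variance (ddevd X K m n h y) = (1 / (real m)\<^sup>2) * (\<Sum>i=1..m. block_variance M X K n h i y)"
    using var by simp
qed

lemma ddevd_mse_eq:
  "ddevd_mse M X FX K m n h y = ((1 / real m) * (\<Sum>i=1..m. block_bias M X FX K n h i y))\<^sup>2
     + (1 / (real m)\<^sup>2) * (\<Sum>i=1..m. block_variance M X K n h i y)"
  unfolding ddevd_mse_def
  by (subst mean_square_deviation[OF integrable_ddevd integrable_ddevd_square])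
    (simp only: expectation_ddevd variance_ddevd)

lemma block_variance_eq:
  assumes "i \<in> {1..m}"
  shows "block_variance M X K n h i y = block_moment M X K n h i y (2 * n i) - (block_moment M X K n h i y (n i))\<^sup>2"
proof -
  have sq: "(inner_approx X K n h i y \<omega> ^ n i)\<^sup>2 = inner_approx X K n h i y \<omega> ^ (2 * n i)" for \<omega>
    by (simp add: mult.commute flip: power_mult)
  show ?thesis
    unfolding block_variance_def block_moment_def
    by (subst variance_eq) (simp_all only: sq integrable_inner_approx_power[OF assms])
qed

text \<open>The sum starts at 3 because orders 0, 1 and 2 have no defect: both laws have mass one,
  are centred and share the variance.\<close>

lemma block_moment_expand:
  assumes i: "i \<in> {1..m}"
  shows "block_moment M X K n h i y N = normal_block_moment M X K n h i y N
           + (\<Sum>k=3..N. real (N choose k) * block_moment M X K n h i y 1 ^ (N - k)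
                * moment_defect M X K n i y k h)"
proof -
  let ?W = "inner_approx X K n h i y"
  let ?t = "\<lambda>k. real (N choose k) * expectation ?W ^ (N - k) * moment_defect M X K n i y k h"
  have "\<bar>?W \<omega>\<bar> \<le> 1" for \<omega>
    using inner_approx_bounds[of h i \<omega>] by simp
  then have "block_moment M X K n h i y N
      = (\<Sum>k\<le>N. real (N choose k) * expectation ?W ^ (N - k) * block_central_moment M X K n h i y k)"
    unfolding block_moment_def block_central_moment_def using i by (intro moment_binomial) auto
  also have "\<dots> = normal_block_moment M X K n h i y N + (\<Sum>k\<le>N. ?t k)"
    unfolding normal_block_moment_def moment_defect_def sum.distrib[symmetric]
    by (simp add: algebra_simps)
  also have "(\<Sum>k\<le>N. ?t k) = (\<Sum>k=3..N. ?t k)"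
  proof (rule sum.mono_neutral_right)
    have "integrable M ?W"
      using integrable_inner_approx_power[OF i, of h 1] by simp
    then have "moment_defect M X K n i y 1 h = 0"
      by (simp add: moment_defect_def block_central_moment_def normal_central_moment_odd prob_space)
    moreover have "moment_defect M X K n i y 0 h = 0" "moment_defect M X K n i y 2 h = 0"
      using normal_central_moment_even[OF variance_positive[of ?W], of 0]
        normal_central_moment_even[OF variance_positive[of ?W], of 1]
      by (simp_all add: moment_defect_def block_central_moment_def odd_dfact_def prob_space)
    moreover have "k = 0 \<or> k = 1 \<or> k = 2" if "k \<in> {..N} - {3..N}" for k
      using that by auto
    ultimately show "\<forall>k\<in>{..N} - {3..N}. ?t k = 0"
      by (metis mult_zero_right)
  qed auto
  finally show ?thesis
    by (simp add: block_moment_def)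
qed

section \<open>Mean and variance of a block\<close>

text \<open>For \<open>t > 0\<close> the distribution function of \<open>X + t U\<close> at
  \<open>y\<close>, where \<open>U\<close> is independent of \<open>X\<close> and follows the kernel
  \<open>L\<close>; used with \<open>K\<close> and with its square.\<close>

definition smoothed_cdf :: "(real \<Rightarrow> real) \<Rightarrow> real \<Rightarrow> real" where
  "smoothed_cdf L t = (\<integral>u. FX (y - t * u) \<partial>kernel_dist L)"

text \<open>\<open>FX\<close> is known to be a distribution function only through the sample; the
  variable with index (1, 1) exists because \<open>m\<close> and \<open>n 1\<close> are
  positive.\<close>

lemma FX_bounds: "\<bar>FX x\<bar> \<le> 1"
proof -
  have "(1, 1) \<in> block_indices m n"
    using m n by (auto simp: block_indices_def Suc_le_eq)
  then have 1: "cdf (distr M borel (X 1 1)) = FX" and "random_variable borel (X 1 1)"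
    using ident by (auto simp: block_indices_def)
  then interpret D: prob_space "distr M borel (X 1 1)"
    by (intro prob_space_distr)
  show ?thesis
    unfolding 1[symmetric] cdf_def using D.prob_le_1 by (simp add: measure_nonneg)
qed

lemma expectation_kernel:
  assumes L: "cdf_kernel L" and i: "i \<in> {1..m}" "j \<in> {1..n i}" and t: "0 < t"
  shows "expectation (\<lambda>\<omega>. L ((y - X i j \<omega>) / t)) = smoothed_cdf L t"
proof -
  have "cdf (distr M borel (X i j)) = FX"
    using ident i by (auto simp: block_indices_def)
  moreover have "isCont FX x" for x
    using C_diff_isCont[OF FX, of 0] by simp
  ultimately have "(\<integral>x. L ((y - x) / t) \<partial>distr M borel (X i j)) = smoothed_cdf L t"
    unfolding smoothed_cdf_def
    using integral_kernel_eq_integral_cdf[OF L real_distribution_distr[OF random_variable_X[OF i]] _ t, of y]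
    by simp
  moreover have [measurable]: "L \<in> borel_measurable borel"
    by (rule cdf_kernel_borel[OF L])
  ultimately show ?thesis
    using random_variable_X[OF i] by (subst (asm) integral_distr) auto
qed

lemma integrable_kernel:
  assumes L: "cdf_kernel L" and i: "i \<in> {1..m}" "j \<in> {1..n i}"
  shows "integrable M (\<lambda>\<omega>. L ((y - X i j \<omega>) / t))"
proof (rule integrable_const_bound[where B = 1])
  have [measurable]: "L \<in> borel_measurable borel"
    by (rule cdf_kernel_borel[OF L])
  show "(\<lambda>\<omega>. L ((y - X i j \<omega>) / t)) \<in> borel_measurable M"
    using random_variable_X[OF i] by measurable
qed (use cdf_kernel_bounds[OF L] in simp)

lemma expectation_inner_approx:
  assumes h: "h \<in> pos_bandwidths m n" and i: "i \<in> {1..m}"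
  shows "expectation (inner_approx X K n h i y) = (1 / real (n i)) * (\<Sum>j=1..n i. smoothed_cdf K (h i j))"
proof -
  have "expectation (inner_approx X K n h i y)
      = (1 / real (n i)) * (\<Sum>j=1..n i. expectation (\<lambda>\<omega>. K ((y - X i j \<omega>) / h i j)))"
    unfolding inner_approx_def using integrable_kernel[OF K i] by (simp add: integral_sum)
  also have "\<dots> = (1 / real (n i)) * (\<Sum>j=1..n i. smoothed_cdf K (h i j))"
    using h i by (simp add: expectation_kernel[OF K] pos_bandwidths_def block_indices_def)
  finally show ?thesis .
qed

text \<open>The square of \<open>K ((y - X) / t)\<close> is the kernel \<open>ksq K\<close> at the
  same point, so second moments are again smoothed distribution functions. The bandwidths vary with
  \<open>j\<close>, so the summands are independent but not identically distributed.\<close>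

lemma variance_inner_approx:
  assumes h: "h \<in> pos_bandwidths m n" and i: "i \<in> {1..m}"
  shows "variance (inner_approx X K n h i y)
    = (1 / (real (n i))\<^sup>2) * (\<Sum>j=1..n i. smoothed_cdf (ksq K) (h i j) - (smoothed_cdf K (h i j))\<^sup>2)"
proof -
  let ?Z = "\<lambda>(i, j) \<omega>. K ((y - X i j \<omega>) / h i j)"
  let ?J = "(\<lambda>j. (i, j)) ` {1..n i}"
  let ?S = "\<lambda>\<omega>. \<Sum>j=1..n i. K ((y - X i j \<omega>) / h i j)"
  note int = integrable_kernel[OF K i] integrable_kernel[OF cdf_kernel_ksq[OF K] i]
  have "indep_vars (\<lambda>_. borel) (\<lambda>p \<omega>. K ((y - (case p of (i, j) \<Rightarrow> X i j) \<omega>) / (case p of (i, j) \<Rightarrow> h i j))) (block_indices m n)"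
    using indep by (rule indep_vars_compose2) measurable
  then have "indep_vars (\<lambda>_. borel) ?Z (block_indices m n)"
    by (simp add: case_prod_beta')
  then have "indep_vars (\<lambda>_. borel) ?Z ?J"
    by (rule indep_vars_subset) (use i in \<open>auto simp: block_indices_def\<close>)
  then have "variance (\<lambda>\<omega>. \<Sum>p\<in>?J. ?Z p \<omega>) = (\<Sum>p\<in>?J. variance (?Z p))"
    using int by (intro square_integrable_sum_indep(2)) auto
  then have "variance ?S = (\<Sum>j=1..n i. variance (\<lambda>\<omega>. K ((y - X i j \<omega>) / h i j)))"
    by (simp add: sum.reindex inj_on_def)
  also have "\<dots> = (\<Sum>j=1..n i. smoothed_cdf (ksq K) (h i j) - (smoothed_cdf K (h i j))\<^sup>2)"
  proof (rule sum.cong[OF refl])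
    fix j assume j: "j \<in> {1..n i}"
    then have "0 < h i j"
      using h i by (auto simp: pos_bandwidths_def block_indices_def)
    then show "variance (\<lambda>\<omega>. K ((y - X i j \<omega>) / h i j))
        = smoothed_cdf (ksq K) (h i j) - (smoothed_cdf K (h i j))\<^sup>2"
      unfolding variance_eq[OF int(1)[OF j] int(2)[OF j]]
      by (simp add: expectation_kernel[OF K i j] expectation_kernel[OF cdf_kernel_ksq[OF K] i j])
  qed
  finally have "variance ?S = \<dots>" .
  moreover have "variance (inner_approx X K n h i y) = expectation (\<lambda>\<omega>. (1 / (real (n i))\<^sup>2) * (?S \<omega> - expectation ?S)\<^sup>2)"
    unfolding inner_approx_def by (simp add: power_divide flip: diff_divide_distrib)
  ultimately show ?thesis by simp
qed

end

section \<open>Expansions in the bandwidths\<close>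

context ddevd_sample
begin

lemma eventually_pos_bandwidths: "\<forall>\<^sub>F h in bw_to_0 m n. h \<in> pos_bandwidths m n"
  unfolding bw_to_0_def by (rule filter_leD[OF inf_le2]) (simp add: eventually_principal)

lemma filterlim_bw_size: "filterlim (bw_size m n) (at_right 0) (bw_to_0 m n)"
  unfolding bw_to_0_def by (rule filterlim_mono[OF filterlim_filtercomap order_refl inf_le1])

lemma bandwidth_le_bw_size:
  assumes "i \<in> {1..m}" "j \<in> {1..n i}"
  shows "h i j \<le> bw_size m n h"
proof -
  have "finite (block_indices m n)"
    by (simp add: block_indices_def)
  moreover have "h i j \<in> (\<lambda>(i, j). h i j) ` block_indices m n"
    using assms by (force simp: block_indices_def)
  ultimately show ?thesis
    unfolding bw_size_def by (intro Max_ge) auto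
qed

lemma eventually_bandwidth:
  assumes "i \<in> {1..m}" "j \<in> {1..n i}"
  shows "\<forall>\<^sub>F h in bw_to_0 m n. 0 < h i j \<and> h i j \<le> bw_size m n h"
  using eventually_pos_bandwidths
  by eventually_elim
    (use assms bandwidth_le_bw_size in \<open>auto simp: pos_bandwidths_def block_indices_def\<close>)

lemma filterlim_bandwidth:
  assumes "i \<in> {1..m}" "j \<in> {1..n i}"
  shows "filterlim (\<lambda>h. h i j) (at_right 0) (bw_to_0 m n)"
proof -
  note ev = eventually_bandwidth[OF assms]
  have "((\<lambda>h. h i j) \<longlongrightarrow> 0) (bw_to_0 m n)"
  proof (rule tendsto_sandwich)
    show "\<forall>\<^sub>F h in bw_to_0 m n. 0 \<le> h i j" "\<forall>\<^sub>F h in bw_to_0 m n. h i j \<le> bw_size m n h"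
      by (rule eventually_mono[OF ev], simp)+
    show "(bw_size m n \<longlongrightarrow> 0) (bw_to_0 m n)"
      using filterlim_bw_size by (simp add: filterlim_at)
  qed simp
  then show ?thesis
    using ev by (auto simp: filterlim_at elim: eventually_mono)
qed

lemma bandwidth_power_bigo:
  assumes "i \<in> {1..m}" "j \<in> {1..n i}"
  shows "(\<lambda>h. h i j ^ p) \<in> O[bw_to_0 m n](\<lambda>h. bw_size m n h ^ p)"
proof (rule bigoI[where c = 1])
  show "\<forall>\<^sub>F h in bw_to_0 m n. norm (h i j ^ p) \<le> 1 * norm (bw_size m n h ^ p)"
    using eventually_bandwidth[OF assms]
    by eventually_elim (auto simp: power_abs intro!: power_mono)
qed

sublocale second_order_remainder "bw_to_0 m n" "bw_size m n" "remainder FX K m n"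
proof
  let ?F = "bw_to_0 m n" and ?s = "bw_size m n"
  show s0: "(?s \<longlongrightarrow> 0) ?F"
    using filterlim_bw_size by (simp add: filterlim_at)
  \<comment> \<open>Places \<open>O(s^3)\<close> inside \<open>o(s^2)\<close>, so that both branches
    of \<open>remainder\<close> satisfy both size conditions of the locale.\<close>
  have cubic: "(\<lambda>h. ?s h ^ 3) \<in> o[?F](\<lambda>h. (?s h)\<^sup>2)"
  proof -
    have "?s \<in> o[?F](\<lambda>_. 1)"
      using s0 by (simp add: smalloI_tendsto)
    from landau_o.small_big_mult[OF this landau_o.big_refl[of "\<lambda>h. (?s h)\<^sup>2"]]
    show ?thesis by (simp add: power2_eq_square power3_eq_cube mult.assoc)
  qed
  fix f g :: "(nat \<Rightarrow> nat \<Rightarrow> real) \<Rightarrow> real"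
  show "f \<in> remainder FX K m n \<Longrightarrow> g \<in> remainder FX K m n \<Longrightarrow> (\<lambda>x. f x + g x) \<in> remainder FX K m n"
    by (auto simp: remainder_def intro: sum_in_bigo sum_in_smallo split: if_splits)
  show "f \<in> remainder FX K m n \<Longrightarrow> g \<in> O[?F](f) \<Longrightarrow> g \<in> remainder FX K m n"
    by (auto simp: remainder_def intro: landau_o.big_trans landau_o.big_small_trans split: if_splits)
  show "f \<in> remainder FX K m n \<Longrightarrow> f \<in> O[?F](\<lambda>h. (?s h)\<^sup>2)"
    using landau_o.small_imp_big[OF cubic]
    by (auto simp: remainder_def intro: landau_o.big_trans landau_o.small_imp_big split: if_splits)
  show "f \<in> O[?F](\<lambda>h. ?s h ^ 3) \<Longrightarrow> f \<in> remainder FX K m n"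
    using cubic by (auto simp: remainder_def intro: landau_o.big_small_trans)
qed

text \<open>The one-variable estimates are composed with the map from \<open>h\<close> to
  \<open>h i j\<close>. No bandwidth exceeds \<open>bw_size\<close>, so their relative sizes do not
  matter.\<close>

lemma smoothed_cdf_expansion:
  assumes L: "L = K \<or> L = ksq K" and i: "i \<in> {1..m}" "j \<in> {1..n i}"
  shows "has_expansion (\<lambda>h. smoothed_cdf L (h i j)) (FX y) (\<lambda>h. - (deriv FX y * kernel_moment L 1) * h i j)
     (\<lambda>h. deriv (deriv FX) y / 2 * kernel_moment L 2 * (h i j)\<^sup>2)"
  unfolding has_expansion_def
proof (intro conjI)
  have L': "cdf_kernel L" "has_kernel_moment L 1" "has_kernel_moment L 2"
    using L K cdf_kernel_ksq[OF K] moments by auto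
  note power = bandwidth_power_bigo[OF i]
  show "(\<lambda>h. - (deriv FX y * kernel_moment L 1) * h i j) \<in> O[bw_to_0 m n](bw_size m n)"
    using power[of 1] by (intro bigo_bounded_mult) auto
  show "(\<lambda>h. deriv (deriv FX) y / 2 * kernel_moment L 2 * (h i j)\<^sup>2) \<in> O[bw_to_0 m n](\<lambda>h. (bw_size m n h)\<^sup>2)"
    using power[of 2] by (intro bigo_bounded_mult) auto
  have "(\<lambda>h. kernel_mean_rest FX L y (h i j)) \<in> remainder FX K m n"
  proof (cases "C_diff 3 FX \<and> has_kernel_moment K 3 \<and> has_kernel_moment (ksq K) 3")
    case True
    then have "kernel_mean_rest FX L y \<in> O[at_right 0](\<lambda>t. t ^ 3)"
      using L by (intro kernel_mean_rest_bigo[OF L'(1) FX_bounds FX L'(2,3)]) auto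
    then have "(\<lambda>h. kernel_mean_rest FX L y (h i j)) \<in> O[bw_to_0 m n](\<lambda>h. h i j ^ 3)"
      using filterlim_bandwidth[OF i] by (rule landau_o.big.compose)
    then show ?thesis
      using True landau_o.big_trans[OF _ power] by (simp add: remainder_def)
  next
    case False
    have "kernel_mean_rest FX L y \<in> o[at_right 0](\<lambda>t. t\<^sup>2)"
      by (rule kernel_mean_rest_smallo[OF L'(1) FX_bounds FX L'(2,3)])
    then have "(\<lambda>h. kernel_mean_rest FX L y (h i j)) \<in> o[bw_to_0 m n](\<lambda>h. (h i j)\<^sup>2)"
      using filterlim_bandwidth[OF i] by (rule landau_o.small.compose)
    then show ?thesis
      using False landau_o.small_big_trans[OF _ power] by (auto simp: remainder_def)
  qed
  then show "(\<lambda>h. smoothed_cdf L (h i j) - (FX y + - (deriv FX y * kernel_moment L 1) * h i j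
      + deriv (deriv FX) y / 2 * kernel_moment L 2 * (h i j)\<^sup>2)) \<in> remainder FX K m n"
    by (simp add: kernel_mean_rest_def smoothed_cdf_def)
qed

lemma mean_expansion:
  assumes i: "i \<in> {1..m}"
  shows "has_expansion (\<lambda>h. expectation (inner_approx X K n h i y)) (FX y)
     (\<lambda>h. - (deriv FX y * kernel_moment K 1) * hbar n h i)
     (\<lambda>h. 1/2 * deriv (deriv FX) y * kernel_moment K 2 * h2bar n h i)"
proof -
  have "n i > 0" using n i by auto
  have "has_expansion (\<lambda>h. \<Sum>j=1..n i. smoothed_cdf K (h i j)) (\<Sum>j=1..n i. FX y)
    (\<lambda>h. \<Sum>j=1..n i. - (deriv FX y * kernel_moment K 1) * h i j)
    (\<lambda>h. \<Sum>j=1..n i. deriv (deriv FX) y / 2 * kernel_moment K 2 * (h i j)\<^sup>2)"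
    by (intro has_expansion_sum smoothed_cdf_expansion i) auto
  then show ?thesis
  proof (rule has_expansion_eq[OF has_expansion_cmult[of _ _ _ _ "1 / real (n i)"]])
    show "\<forall>\<^sub>F h in bw_to_0 m n. 1 / real (n i) * (\<Sum>j=1..n i. smoothed_cdf K (h i j))
        = expectation (inner_approx X K n h i y)"
      using eventually_pos_bandwidths by eventually_elim (simp add: expectation_inner_approx[OF _ i])
  next
    show "1 / real (n i) * (\<Sum>j=1..n i. - (deriv FX y * kernel_moment K 1) * h i j)
        = - (deriv FX y * kernel_moment K 1) * hbar n h i" for h
      unfolding sum_distrib_left[symmetric] hbar_def by simp
    show "1 / real (n i) * (\<Sum>j=1..n i. deriv (deriv FX) y / 2 * kernel_moment K 2 * (h i j)\<^sup>2)
        = 1/2 * deriv (deriv FX) y * kernel_moment K 2 * h2bar n h i" for h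
      unfolding sum_distrib_left[symmetric] h2bar_def by simp
  qed (use \<open>n i > 0\<close> in simp)
qed

text \<open>The origin of \<open>coeff_alpha\<close> and \<open>coeff_beta\<close>: they are, up to
  sign for the former, the coefficients of the mean of \<open>ksq K\<close> minus the squared mean
  of \<open>K\<close> in one bandwidth. The squared linear term of that mean is the last term of
  \<open>coeff_beta\<close>. Of the factor \<open>1 / n^2\<close>, one half forms the averages and
  the other remains.\<close>

lemma variance_expansion_inner_approx:
  assumes i: "i \<in> {1..m}"
  shows "has_expansion (\<lambda>h. variance (inner_approx X K n h i y)) (FX y * (1 - FX y) / real (n i))
     (\<lambda>h. - (coeff_alpha FX K y / real (n i)) * hbar n h i)
     (\<lambda>h. coeff_beta FX K y / real (n i) * h2bar n h i)"
proof -
  have "n i > 0" using n i by auto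
  have summand: "has_expansion (\<lambda>h. smoothed_cdf (ksq K) (h i j) - (smoothed_cdf K (h i j))\<^sup>2)
     (FX y * (1 - FX y)) (\<lambda>h. - coeff_alpha FX K y * h i j) (\<lambda>h. coeff_beta FX K y * (h i j)\<^sup>2)"
    if j: "j \<in> {1..n i}" for j
    by (rule has_expansion_eq[OF has_expansion_diff[OF smoothed_cdf_expansion[OF _ i j]
          has_expansion_power[OF smoothed_cdf_expansion[OF _ i j], where N = 2]]])
      (auto simp: coeff_alpha_def coeff_beta_def field_simps power2_eq_square)
  have "has_expansion (\<lambda>h. \<Sum>j=1..n i. smoothed_cdf (ksq K) (h i j) - (smoothed_cdf K (h i j))\<^sup>2)
    (\<Sum>j=1..n i. FX y * (1 - FX y)) (\<lambda>h. \<Sum>j=1..n i. - coeff_alpha FX K y * h i j)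
    (\<lambda>h. \<Sum>j=1..n i. coeff_beta FX K y * (h i j)\<^sup>2)"
    by (intro has_expansion_sum summand)
  then show ?thesis
  proof (rule has_expansion_eq[OF has_expansion_cmult[of _ _ _ _ "1 / (real (n i))\<^sup>2"]])
    show "\<forall>\<^sub>F h in bw_to_0 m n. 1 / (real (n i))\<^sup>2 *
        (\<Sum>j=1..n i. smoothed_cdf (ksq K) (h i j) - (smoothed_cdf K (h i j))\<^sup>2)
        = variance (inner_approx X K n h i y)"
      using eventually_pos_bandwidths by eventually_elim (simp add: variance_inner_approx[OF _ i])
  next
    show "1 / (real (n i))\<^sup>2 * (\<Sum>j=1..n i. - coeff_alpha FX K y * h i j)
        = - (coeff_alpha FX K y / real (n i)) * hbar n h i" for h
      unfolding sum_distrib_left[symmetric] hbar_def by (simp add: power2_eq_square)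
    show "1 / (real (n i))\<^sup>2 * (\<Sum>j=1..n i. coeff_beta FX K y * (h i j)\<^sup>2)
        = coeff_beta FX K y / real (n i) * h2bar n h i" for h
      unfolding sum_distrib_left[symmetric] h2bar_def by (simp add: power2_eq_square)
  qed (use \<open>n i > 0\<close> in \<open>simp add: power2_eq_square\<close>)
qed

section \<open>Expansions of moments, bias, variance and mean squared error\<close>

lemma normal_block_moment_expansion:
  assumes i: "i \<in> {1..m}"
  shows "has_expansion (\<lambda>h. normal_block_moment M X K n h i y N) (coeff_E0 FX y (n i) N)
     (\<lambda>h. hbar n h i * coeff_E1 FX K y (n i) N)
     (\<lambda>h. h2bar n h i * coeff_E2a FX K y (n i) N + (hbar n h i)\<^sup>2 * coeff_E2b FX K y (n i) N)"
proof -
  have "0 < n i" using n i by auto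
  from has_expansion_normal_moment[OF this mean_expansion[OF i] variance_expansion_inner_approx[OF i]]
  show ?thesis
    unfolding normal_block_moment_def by (simp add: variance_positive)
qed

text \<open>Each defect is multiplied by a constant and a power of the mean, which stays bounded.
  The whole correction therefore lies in the remainder and leaves the coefficients
  unchanged.\<close>

lemma block_moment_expansion:
  assumes i: "i \<in> {1..m}" and defect: "\<forall>k\<in>{3..N}. moment_defect M X K n i y k \<in> remainder FX K m n"
  shows "has_expansion (\<lambda>h. block_moment M X K n h i y N) (coeff_E0 FX y (n i) N)
     (\<lambda>h. hbar n h i * coeff_E1 FX K y (n i) N)
     (\<lambda>h. h2bar n h i * coeff_E2a FX K y (n i) N + (hbar n h i)\<^sup>2 * coeff_E2b FX K y (n i) N)"
proof -
  let ?D = "\<lambda>h. \<Sum>k=3..N. real (N choose k) * block_moment M X K n h i y 1 ^ (N - k) * moment_defect M X K n i y k h"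
  have "(\<lambda>h. block_moment M X K n h i y 1) \<in> O[bw_to_0 m n](\<lambda>_. 1)"
    using has_expansion_bigo_1[OF mean_expansion[OF i]] by (simp add: block_moment_def)
  then have "(\<lambda>h. real (N choose k) * block_moment M X K n h i y 1 ^ p) \<in> O[bw_to_0 m n](\<lambda>_. 1)" for k p
    using landau_o.big_power[of _ _ "\<lambda>_. 1" p] by (intro bigo_bounded_mult) auto
  then have "?D \<in> remainder FX K m n"
    using defect by (intro R_sum R_mult) auto
  then have "has_expansion ?D 0 (\<lambda>_. 0) (\<lambda>_. 0)"
    by (simp add: has_expansion_def)
  then show ?thesis
  proof (rule has_expansion_eq[OF has_expansion_add[OF normal_block_moment_expansion[OF i]]])
    show "\<forall>\<^sub>F h in bw_to_0 m n. normal_block_moment M X K n h i y N + ?D h = block_moment M X K n h i y N"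
      by (intro always_eventually allI block_moment_expand[OF i, symmetric])
  qed simp_all
qed

text \<open>\<open>Q\<close> stands for the exact or the replaced moment, so one derivation serves
  both; the same holds for the variance and the squared error below.\<close>

lemma block_bias_expansion:
  assumes "has_expansion (\<lambda>h. Q h) (coeff_E0 FX y (n i) (n i))
     (\<lambda>h. hbar n h i * coeff_E1 FX K y (n i) (n i))
     (\<lambda>h. h2bar n h i * coeff_E2a FX K y (n i) (n i) + (hbar n h i)\<^sup>2 * coeff_E2b FX K y (n i) (n i))"
  shows "has_expansion (\<lambda>h. Q h - FX y ^ n i) (coeff_b0 FX y (n i))
     (\<lambda>h. hbar n h i * coeff_b1 FX K y (n i))
     (\<lambda>h. h2bar n h i * coeff_b2a FX K y (n i) + (hbar n h i)\<^sup>2 * coeff_b2b FX K y (n i))"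
  using has_expansion_diff[OF assms has_expansion_const[of "FX y ^ n i"]]
  by (simp add: coeff_b0_def coeff_b1_def coeff_b2a_def coeff_b2b_def)

text \<open>Subtracting the squared expansion at \<open>n i\<close> gives the coefficients; the
  square of its linear part is the last term of \<open>coeff_V2b\<close>.\<close>

lemma block_variance_expansion:
  assumes "\<And>N. N = n i \<or> N = 2 * n i \<Longrightarrow> has_expansion (\<lambda>h. Q h N) (coeff_E0 FX y (n i) N)
     (\<lambda>h. hbar n h i * coeff_E1 FX K y (n i) N)
     (\<lambda>h. h2bar n h i * coeff_E2a FX K y (n i) N + (hbar n h i)\<^sup>2 * coeff_E2b FX K y (n i) N)"
  shows "has_expansion (\<lambda>h. Q h (2 * n i) - (Q h (n i))\<^sup>2) (coeff_V0 FX y (n i))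
     (\<lambda>h. hbar n h i * coeff_V1 FX K y (n i))
     (\<lambda>h. h2bar n h i * coeff_V2a FX K y (n i) + (hbar n h i)\<^sup>2 * coeff_V2b FX K y (n i))"
  by (rule has_expansion_eq[OF has_expansion_diff[OF assms has_expansion_power[OF assms, where N = 2]]])
    (auto simp: coeff_V0_def coeff_V1_def coeff_V2a_def coeff_V2b_def power2_eq_square algebra_simps)

lemma bias_expansion_remainder:
  assumes "has_expansion B (coeff_b0 FX y (n i)) (\<lambda>h. hbar n h i * coeff_b1 FX K y (n i))
     (\<lambda>h. h2bar n h i * coeff_b2a FX K y (n i) + (hbar n h i)\<^sup>2 * coeff_b2b FX K y (n i))"
  shows "(\<lambda>h. B h - bias_expansion FX K n h i y) \<in> remainder FX K m n"
  using assms by (simp add: has_expansion_def bias_expansion_def algebra_simps)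

lemma variance_expansion_remainder:
  assumes "has_expansion V (coeff_V0 FX y (n i)) (\<lambda>h. hbar n h i * coeff_V1 FX K y (n i))
     (\<lambda>h. h2bar n h i * coeff_V2a FX K y (n i) + (hbar n h i)\<^sup>2 * coeff_V2b FX K y (n i))"
  shows "(\<lambda>h. V h - variance_expansion FX K n h i y) \<in> remainder FX K m n"
  using assms by (simp add: has_expansion_def variance_expansion_def algebra_simps)

lemma mse_expansion_remainder:
  assumes B: "\<And>i. i \<in> {1..m} \<Longrightarrow> has_expansion (B i) (coeff_b0 FX y (n i))
       (\<lambda>h. hbar n h i * coeff_b1 FX K y (n i))
       (\<lambda>h. h2bar n h i * coeff_b2a FX K y (n i) + (hbar n h i)\<^sup>2 * coeff_b2b FX K y (n i))"
    and V: "\<And>i. i \<in> {1..m} \<Longrightarrow> has_expansion (V i) (coeff_V0 FX y (n i))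
       (\<lambda>h. hbar n h i * coeff_V1 FX K y (n i))
       (\<lambda>h. h2bar n h i * coeff_V2a FX K y (n i) + (hbar n h i)\<^sup>2 * coeff_V2b FX K y (n i))"
  shows "(\<lambda>h. ((1 / real m) * (\<Sum>i=1..m. B i h))\<^sup>2 + (1 / (real m)\<^sup>2) * (\<Sum>i=1..m. V i h)
            - mse_expansion FX K m n h y) \<in> remainder FX K m n"
proof -
  note SB = has_expansion_sum[where I = "{1..m}", OF B] and SV = has_expansion_sum[where I = "{1..m}", OF V]
  have "has_expansion (\<lambda>h. (1 / (real m)\<^sup>2) * ((\<Sum>i=1..m. B i h)\<^sup>2 + (\<Sum>i=1..m. V i h)))
    ((1 / (real m)\<^sup>2) * ((\<Sum>i=1..m. coeff_b0 FX y (n i))\<^sup>2 + (\<Sum>i=1..m. coeff_V0 FX y (n i))))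
    (\<lambda>h. (1 / (real m)\<^sup>2) *
       (2 * (\<Sum>i=1..m. coeff_b0 FX y (n i)) * (\<Sum>i=1..m. hbar n h i * coeff_b1 FX K y (n i))
        + (\<Sum>i=1..m. hbar n h i * coeff_V1 FX K y (n i))))
    (\<lambda>h. (1 / (real m)\<^sup>2) *
       ((\<Sum>i=1..m. hbar n h i * coeff_b1 FX K y (n i))\<^sup>2
        + 2 * (\<Sum>i=1..m. coeff_b0 FX y (n i))
            * ((\<Sum>i=1..m. h2bar n h i * coeff_b2a FX K y (n i))
               + (\<Sum>i=1..m. (hbar n h i)\<^sup>2 * coeff_b2b FX K y (n i)))
        + (\<Sum>i=1..m. h2bar n h i * coeff_V2a FX K y (n i) + (hbar n h i)\<^sup>2 * coeff_V2b FX K y (n i))))"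
    by (rule has_expansion_eq[OF has_expansion_cmult[where k = "1 / (real m)\<^sup>2", OF has_expansion_add[OF has_expansion_power[OF SB, where N = 2] SV]]])
      (auto simp: sum.distrib algebra_simps intro!: always_eventually)
  then show ?thesis
    by (simp add: has_expansion_def mse_expansion_def power_mult_distrib power_divide ring_distribs add_divide_distrib)
qed

end

theorem theorem2p1:
  fixes M :: "'a measure" and X :: "nat \<Rightarrow> nat \<Rightarrow> 'a \<Rightarrow> real"
    and FX K :: "real \<Rightarrow> real" and m :: nat and n :: "nat \<Rightarrow> nat" and y :: real
  assumes M: "prob_space M"
    and m: "m > 0" and n: "\<forall>i\<in>{1..m}. n i > 0"
    and indep: "prob_space.indep_vars M (\<lambda>_. borel) (\<lambda>(i, j). X i j) (block_indices m n)"
    and ident: "\<forall>(i, j)\<in>block_indices m n. cdf (distr M borel (X i j)) = FX"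
    and FX: "C_diff 2 FX"
    and K: "cdf_kernel K"
    and moments: "\<forall>p\<in>{1, 2}. has_kernel_moment K p \<and> has_kernel_moment (ksq K) p"
  shows
    "(\<forall>h\<in>pos_bandwidths m n.
       (\<integral>\<omega>. ddevd X K m n h y \<omega> \<partial>M) - target_cdf FX m n y
         = (1 / real m) * (\<Sum>i=1..m. block_bias M X FX K n h i y)
     \<and> prob_space.variance M (ddevd X K m n h y)
         = (1 / (real m)\<^sup>2) * (\<Sum>i=1..m. block_variance M X K n h i y)
     \<and> ddevd_mse M X FX K m n h y
         = ((1 / real m) * (\<Sum>i=1..m. block_bias M X FX K n h i y))\<^sup>2
           + (1 / (real m)\<^sup>2) * (\<Sum>i=1..m. block_variance M X K n h i y))
   \<and> (\<forall>h\<in>pos_bandwidths m n. \<forall>i\<in>{1..m}. \<forall>N.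
       block_moment M X K n h i y N
         = normal_block_moment M X K n h i y N
           + (\<Sum>k=3..N. real (N choose k) * block_moment M X K n h i y 1 ^ (N - k)
                * moment_defect M X K n i y k h))
   \<and> (\<forall>i\<in>{1..m}. (\<lambda>h. normal_block_bias M X FX K n h i y - bias_expansion FX K n h i y)
                      \<in> remainder FX K m n)
   \<and> (\<forall>i\<in>{1..m}. (\<lambda>h. normal_block_variance M X K n h i y - variance_expansion FX K n h i y)
                      \<in> remainder FX K m n)
   \<and> ((\<lambda>h. normal_mse M X FX K m n h y - mse_expansion FX K m n h y) \<in> remainder FX K m n)
   \<and> (\<forall>i\<in>{1..m}. (\<forall>k\<in>{3..n i}. moment_defect M X K n i y k \<in> remainder FX K m n) \<longrightarrow>
           (\<lambda>h. block_bias M X FX K n h i y - bias_expansion FX K n h i y) \<in> remainder FX K m n)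
   \<and> (\<forall>i\<in>{1..m}. (\<forall>k\<in>{3..2 * n i}. moment_defect M X K n i y k \<in> remainder FX K m n) \<longrightarrow>
           (\<lambda>h. block_variance M X K n h i y - variance_expansion FX K n h i y) \<in> remainder FX K m n)
   \<and> ((\<forall>i\<in>{1..m}. \<forall>k\<in>{3..2 * n i}. moment_defect M X K n i y k \<in> remainder FX K m n) \<longrightarrow>
           (\<lambda>h. ddevd_mse M X FX K m n h y - mse_expansion FX K m n h y) \<in> remainder FX K m n)"
proof -
  interpret ddevd_sample M X FX K m n y
    using assms by (simp add: ddevd_sample_def ddevd_sample_axioms_def)
  have bias: "block_bias M X FX K n h i y = block_moment M X K n h i y (n i) - FX y ^ n i" for h i
    by (simp add: block_bias_def block_moment_def)
  have normal_bias: "has_expansion (\<lambda>h. normal_block_bias M X FX K n h i y) (coeff_b0 FX y (n i))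
      (\<lambda>h. hbar n h i * coeff_b1 FX K y (n i))
      (\<lambda>h. h2bar n h i * coeff_b2a FX K y (n i) + (hbar n h i)\<^sup>2 * coeff_b2b FX K y (n i))"
    if i: "i \<in> {1..m}" for i
    unfolding normal_block_bias_def
    by (rule block_bias_expansion[OF normal_block_moment_expansion[OF i]])
  have normal_variance: "has_expansion (\<lambda>h. normal_block_variance M X K n h i y) (coeff_V0 FX y (n i))
      (\<lambda>h. hbar n h i * coeff_V1 FX K y (n i))
      (\<lambda>h. h2bar n h i * coeff_V2a FX K y (n i) + (hbar n h i)\<^sup>2 * coeff_V2b FX K y (n i))"
    if i: "i \<in> {1..m}" for i
    unfolding normal_block_variance_def
    by (rule block_variance_expansion[where Q = "\<lambda>h N. normal_block_moment M X K n h i y N",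
          OF normal_block_moment_expansion[OF i]])
  \<comment> \<open>The bias involves only the moment of order \<open>n i\<close>, the variance also
    that of order \<open>2 * n i\<close>; hence the different ranges of the premises on the
    defects.\<close>
  have block_bias: "has_expansion (\<lambda>h. block_bias M X FX K n h i y) (coeff_b0 FX y (n i))
      (\<lambda>h. hbar n h i * coeff_b1 FX K y (n i))
      (\<lambda>h. h2bar n h i * coeff_b2a FX K y (n i) + (hbar n h i)\<^sup>2 * coeff_b2b FX K y (n i))"
    if "i \<in> {1..m}" "\<forall>k\<in>{3..n i}. moment_defect M X K n i y k \<in> remainder FX K m n" for i
    unfolding bias by (rule block_bias_expansion[OF block_moment_expansion[OF that]])
  have block_variance: "has_expansion (\<lambda>h. block_variance M X K n h i y) (coeff_V0 FX y (n i))
      (\<lambda>h. hbar n h i * coeff_V1 FX K y (n i))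
      (\<lambda>h. h2bar n h i * coeff_V2a FX K y (n i) + (hbar n h i)\<^sup>2 * coeff_V2b FX K y (n i))"
    if i: "i \<in> {1..m}" and defect: "\<forall>k\<in>{3..2 * n i}. moment_defect M X K n i y k \<in> remainder FX K m n" for i
    unfolding block_variance_eq[OF i]
    by (rule block_variance_expansion[where Q = "\<lambda>h N. block_moment M X K n h i y N",
          OF block_moment_expansion[OF i]]) (use defect in auto)
  show ?thesis
  proof (intro conjI ballI allI impI)
    show "(\<lambda>h. normal_mse M X FX K m n h y - mse_expansion FX K m n h y) \<in> remainder FX K m n"
      unfolding normal_mse_def by (rule mse_expansion_remainder[OF normal_bias normal_variance])
    show "(\<lambda>h. ddevd_mse M X FX K m n h y - mse_expansion FX K m n h y) \<in> remainder FX K m n"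
      if "\<forall>i\<in>{1..m}. \<forall>k\<in>{3..2 * n i}. moment_defect M X K n i y k \<in> remainder FX K m n"
      unfolding ddevd_mse_eq
      by (rule mse_expansion_remainder[OF block_bias block_variance]) (use that in auto)
    fix i assume i: "i \<in> {1..m}"
    show "(\<lambda>h. normal_block_bias M X FX K n h i y - bias_expansion FX K n h i y) \<in> remainder FX K m n"
      by (rule bias_expansion_remainder[OF normal_bias[OF i]])
    show "(\<lambda>h. normal_block_variance M X K n h i y - variance_expansion FX K n h i y) \<in> remainder FX K m n"
      by (rule variance_expansion_remainder[OF normal_variance[OF i]])
    show "(\<lambda>h. block_bias M X FX K n h i y - bias_expansion FX K n h i y) \<in> remainder FX K m n"
      if "\<forall>k\<in>{3..n i}. moment_defect M X K n i y k \<in> remainder FX K m n"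
      by (rule bias_expansion_remainder[OF block_bias[OF i that]])
    show "(\<lambda>h. block_variance M X K n h i y - variance_expansion FX K n h i y) \<in> remainder FX K m n"
      if "\<forall>k\<in>{3..2 * n i}. moment_defect M X K n i y k \<in> remainder FX K m n"
      by (rule variance_expansion_remainder[OF block_variance[OF i that]])
  qed (rule expectation_ddevd variance_ddevd ddevd_mse_eq block_moment_expand; assumption)+
qed

end
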